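(* For every $\alpha>0$, \[\lim_{\lambda\to\infty}\liminf_{t\to\infty}\mathbf{P}\left(\lambda^{-1}\le \phi_\alpha(t)^{-1}p_t^\omega(0,0)\le\lambda\right)=1.\]
   Context: One-dimensional symmetric Bouchaud trap model. Fix $\alpha>0$. Let $\tau=\{\tau_x\}_{x\in\mathbb{Z}}$ be i.i.d. random variables (the random environment, with law $\mathbf{P}$ and expectation $\mathbf{E}$; $\omega$ denotes a realisation of the environment) with $\mathbf{P}(\tau_x>u)=u^{-\alpha}$ for all $u\ge 1$. Given $\tau$, let $X=(X_t)_{t\ge0}$ be the continuous-time Markov chain on $\mathbb{Z}$ with generator $\mathcal{L}f(x)=\frac{1}{2\tau_x}\sum_{y\sim x}(f(y)-f(x))$ (sum over the two nearest neighbours of $x$). Write $P^\omega_x$ for the quenched law of $X$ started at $x$. The quenched heat kernel is $p_t^\omega(x,y)=P^\omega_x(X_t=y)/\tau_y$. Define $\phi_\alpha(t)=t^{-1/(1+\alpha)}$ if $\alpha\in(0,1)$, $\phi_\alpha(t)=t^{-1/2}(\log t)^{-1/2}$ if $\alpha=1$, and $\phi_\alpha(t)=t^{-1/2}$ if $\alpha>1$. *)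

theory Defs
  imports "HOL-Probability.Probability"
begin

text \<open>Generator matrix of the symmetric Bouchaud trap model in environment tau:
  (L f)(x) = 1/(2 tau x) * sum over neighbours y of (f y - f x).\<close>
definition bouchaud_gen :: "(int \<Rightarrow> real) \<Rightarrow> int \<Rightarrow> int \<Rightarrow> real" where
  "bouchaud_gen tau x y =
     (if y = x + 1 \<or> y = x - 1 then 1 / (2 * tau x)
      else if y = x then - (1 / tau x) else 0)"

text \<open>Matrix powers of the generator (only nearest-neighbour entries are nonzero).\<close>
fun gen_pow :: "(int \<Rightarrow> real) \<Rightarrow> nat \<Rightarrow> int \<Rightarrow> int \<Rightarrow> real" where
  "gen_pow tau 0 x y = (if x = y then 1 else 0)"
| "gen_pow tau (Suc n) x y = (\<Sum>z\<in>{x - 1..x + 1}. bouchaud_gen tau x z * gen_pow tau n z y)"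

text \<open>Quenched transition probability P_x(X_t = y) = (exp (t L))(x,y).
  Since tau \<ge> 1 the generator is bounded, so the semigroup is the exponential series.\<close>
definition trans_prob :: "(int \<Rightarrow> real) \<Rightarrow> real \<Rightarrow> int \<Rightarrow> int \<Rightarrow> real" where
  "trans_prob tau t x y = (\<Sum>n. t ^ n / fact n * gen_pow tau n x y)"

definition heat_kernel :: "(int \<Rightarrow> real) \<Rightarrow> real \<Rightarrow> int \<Rightarrow> int \<Rightarrow> real" where
  "heat_kernel tau t x y = trans_prob tau t x y / tau y"

definition phi_alpha :: "real \<Rightarrow> real \<Rightarrow> real" where
  "phi_alpha alpha t =
     (if alpha < 1 then t powr (- 1 / (1 + alpha))
      else if alpha = 1 then t powr (- 1 / 2) * (ln t) powr (- 1 / 2)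
      else t powr (- 1 / 2))"

end

theory Submission
  imports Defs "HOL-Real_Asymp.Real_Asymp"
begin

text \<open>
  Write \<open>V(r)\<close> for the total depth of the traps in \<open>[-r, r]\<close>. Two deterministic estimates hold in every
  environment with \<open>\<tau> \<ge> 1\<close>. Let \<open>u\<close> be the density of the expected occupation time up to \<open>t\<close>. Its Dirichlet
  energy is at most of order \<open>u(0)\<close> and its total mass is \<open>t\<close>, so the minimum of \<open>u\<close> over \<open>[-\<rho>, \<rho>]\<close> is at
  most \<open>t / V(\<rho>)\<close> and \<open>u(0)\<close> is at most of order \<open>t / V(\<rho>) + \<rho>\<close>; since the heat kernel decreases in time,
  \<open>p\<^sub>t(0,0)\<close> is at most of order \<open>1 / V(\<rho>) + \<rho> / t\<close>. Conversely, testing against a tent function of width \<open>r\<close>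
  shows that the walk is still in \<open>[-r, r]\<close> with probability at least \<open>1 - u(0) / r\<close>, up to a constant in front
  of \<open>u(0)\<close>, and then Cauchy--Schwarz gives \<open>p\<^sub>t(0,0) \<ge> c / V(r)\<close> once \<open>r\<close> is a large multiple of \<open>u(0)\<close>.

  With \<open>\<rho> = t \<phi>(t)\<close> and \<open>r = C \<rho>\<close>, everything reduces to \<open>V(\<rho>)\<close> and \<open>V(C \<rho>)\<close> being of order \<open>1 / \<phi>(t)\<close>
  with high probability. The lower bound is a Chernoff bound, the upper bound a truncated first moment bound,
  and both only involve the truncated mean \<open>E min(\<tau>, T)\<close>.

  All sums over the lattice are made finite by replacing the continuous-time walk with a lazy discrete-time
  walk, observed at a Poisson time.
\<close>

section \<open>Deterministic heat kernel bounds\<close>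

definition finsupp :: "(int \<Rightarrow> real) \<Rightarrow> bool" where
  "finsupp f \<longleftrightarrow> finite {x. f x \<noteq> 0}"

text \<open>An infinite sum that fails to converge has the default value 0, so each splitting or
  comparison of sums below needs summability; finite support supplies it.\<close>

lemma finsupp_summable: "finsupp f \<Longrightarrow> f summable_on UNIV"
  unfolding finsupp_def by (rule finite_nonzero_values_imp_summable_on) simp

lemma finsupp_mono: "finsupp f \<Longrightarrow> (\<And>x. f x = 0 \<Longrightarrow> g x = 0) \<Longrightarrow> finsupp g"
  unfolding finsupp_def by (erule rev_finite_subset) auto

lemma finsupp_add: "finsupp f \<Longrightarrow> finsupp g \<Longrightarrow> finsupp (\<lambda>x. f x + g x)"
  unfolding finsupp_def
  by (rule finite_subset[of _ "{x. f x \<noteq> 0} \<union> {x. g x \<noteq> 0}"]) auto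

lemma finsupp_diff: "finsupp f \<Longrightarrow> finsupp g \<Longrightarrow> finsupp (\<lambda>x. f x - g x)"
  unfolding finsupp_def
  by (rule finite_subset[of _ "{x. f x \<noteq> 0} \<union> {x. g x \<noteq> 0}"]) auto

lemma finsupp_mult_left: "finsupp f \<Longrightarrow> finsupp (\<lambda>x. f x * h x)"
  by (erule finsupp_mono) simp

lemma finsupp_mult_right: "finsupp f \<Longrightarrow> finsupp (\<lambda>x. h x * f x)"
  by (erule finsupp_mono) simp

lemma finsupp_divide: "finsupp f \<Longrightarrow> finsupp (\<lambda>x. f x / h x)"
  by (erule finsupp_mono) simp

lemma finsupp_power: "finsupp f \<Longrightarrow> finsupp (\<lambda>x. (f x)\<^sup>2)"
  by (erule finsupp_mono) simp

lemma finsupp_shift: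
  assumes "finsupp f"
  shows "finsupp (\<lambda>x. f (x + k))"
proof -
  have "{x. f (x + k) \<noteq> 0} \<subseteq> (\<lambda>x. x - k) ` {x. f x \<noteq> 0}"
    by (force simp: image_iff)
  then show ?thesis
    using assms unfolding finsupp_def by (meson finite_imageI finite_subset)
qed

lemma finsupp_shift_minus: "finsupp f \<Longrightarrow> finsupp (\<lambda>x. f (x - k))"
  using finsupp_shift[of f "- k"] by simp

lemma finsupp_sum: "(\<And>i. i \<in> I \<Longrightarrow> finsupp (F i)) \<Longrightarrow> finsupp (\<lambda>x. \<Sum>i\<in>I. F i x)"
proof (induction I rule: infinite_finite_induct)
  case (insert i I)
  then show ?case by (simp add: finsupp_add)
qed (simp_all add: finsupp_def)

lemmas finsupp_intros = finsupp_add finsupp_diff finsupp_mult_left finsupp_mult_right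
  finsupp_divide finsupp_power

lemma infsum_minus:
  fixes f g :: "int \<Rightarrow> real"
  assumes "f summable_on UNIV" "g summable_on UNIV"
  shows "(\<Sum>\<^sub>\<infinity>x. f x - g x) = (\<Sum>\<^sub>\<infinity>x. f x) - (\<Sum>\<^sub>\<infinity>x. g x)"
  using infsum_add[of f UNIV "\<lambda>x. - g x"] assms by (simp add: infsum_uminus summable_on_uminus)

lemma infsum_shift: "(\<Sum>\<^sub>\<infinity>x. h (x + k)) = (\<Sum>\<^sub>\<infinity>x. (h :: int \<Rightarrow> real) x)"
proof (rule infsum_reindex_bij_betw)
  show "bij (\<lambda>x. x + k)"
    by (rule o_bij[of "\<lambda>x. x - k"]) auto
qed

section \<open>Discrete Laplacian, summation by parts and Dirichlet energy\<close>

definition lap :: "(int \<Rightarrow> real) \<Rightarrow> int \<Rightarrow> real" where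
  "lap f x = f (x + 1) + f (x - 1) - 2 * f x"

lemma finsupp_lap:
  assumes "finsupp f"
  shows "finsupp (lap f)"
  unfolding lap_def[abs_def]
  by (intro finsupp_intros assms finsupp_shift[OF assms] finsupp_shift_minus[OF assms])

text \<open>Summation by parts: translation moves each neighbour term from \<open>f\<close> to
  \<open>g\<close>. Since \<open>g\<close> is arbitrary, it may later be the constant 1.\<close>

lemma infsum_lap_mult:
  assumes f: "finsupp f"
  shows "(\<Sum>\<^sub>\<infinity>x. lap f x * g x) = (\<Sum>\<^sub>\<infinity>x. f x * lap g x)"
proof -
  note s = finsupp_intros f finsupp_shift[OF f] finsupp_shift_minus[OF f]
  have eq: "f (x + 1) * g x + f (x - 1) * g x - 2 * (f x * g x) = lap f x * g x"
       "f x * g (x - 1) + f x * g (x + 1) - 2 * (f x * g x) = f x * lap g x" for x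
    by (simp_all add: lap_def algebra_simps)
  have sp: "(\<lambda>x. f (x + 1) * g x) summable_on UNIV" "(\<lambda>x. f (x - 1) * g x) summable_on UNIV"
     "(\<lambda>x. f x * g x) summable_on UNIV" "(\<lambda>x. f x * g (x - 1)) summable_on UNIV"
     "(\<lambda>x. f x * g (x + 1)) summable_on UNIV"
    by (intro finsupp_summable s)+
  have sh: "(\<Sum>\<^sub>\<infinity>x. f (x + 1) * g x) = (\<Sum>\<^sub>\<infinity>x. f x * g (x - 1))"
    using infsum_shift[of "\<lambda>x. f x * g (x - 1)" 1] by simp
  have sh': "(\<Sum>\<^sub>\<infinity>x. f (x - 1) * g x) = (\<Sum>\<^sub>\<infinity>x. f x * g (x + 1))"
    using infsum_shift[of "\<lambda>x. f x * g (x + 1)" "-1"] by simp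
  have "(\<Sum>\<^sub>\<infinity>x. lap f x * g x)
      = (\<Sum>\<^sub>\<infinity>x. f (x + 1) * g x) + (\<Sum>\<^sub>\<infinity>x. f (x - 1) * g x) - 2 * (\<Sum>\<^sub>\<infinity>x. f x * g x)"
    unfolding eq(1)[symmetric]
    by (simp add: infsum_minus infsum_add sp infsum_cmult_right' summable_on_add summable_on_cmult_right)
  also have "\<dots> = (\<Sum>\<^sub>\<infinity>x. f x * lap g x)"
    unfolding eq(2)[symmetric] sh sh'
    by (simp add: infsum_minus infsum_add sp infsum_cmult_right' summable_on_add summable_on_cmult_right)
  finally show ?thesis .
qed

definition energy :: "(int \<Rightarrow> real) \<Rightarrow> real" where
  "energy f = (\<Sum>\<^sub>\<infinity>x. (f (x + 1) - f x)\<^sup>2)"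

lemma infsum_mult_lap_self:
  assumes f: "finsupp f"
  shows "(\<Sum>\<^sub>\<infinity>x. f x * lap f x) = - energy f"
proof -
  note s = finsupp_intros f finsupp_shift[OF f] finsupp_shift_minus[OF f]
  have sp: "(\<lambda>x. f (x + 1) * f x) summable_on UNIV" "(\<lambda>x. f (x - 1) * f x) summable_on UNIV"
     "(\<lambda>x. (f x)\<^sup>2) summable_on UNIV" "(\<lambda>x. (f (x + 1))\<^sup>2) summable_on UNIV"
    by (intro finsupp_summable s)+
  have eq: "f (x + 1) * f x + f (x - 1) * f x - 2 * (f x)\<^sup>2 = f x * lap f x"
    "(f (x + 1))\<^sup>2 + (f x)\<^sup>2 - 2 * (f (x + 1) * f x) = (f (x + 1) - f x)\<^sup>2" for x
    by (simp_all add: lap_def algebra_simps power2_eq_square)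
  have sh: "(\<Sum>\<^sub>\<infinity>x. f (x - 1) * f x) = (\<Sum>\<^sub>\<infinity>x. f (x + 1) * f x)"
    using infsum_shift[of "\<lambda>x. f (x - 1) * f x" 1] by (simp add: mult.commute)
  have sh': "(\<Sum>\<^sub>\<infinity>x. (f (x + 1))\<^sup>2) = (\<Sum>\<^sub>\<infinity>x. (f x)\<^sup>2)"
    using infsum_shift[of "\<lambda>x. (f x)\<^sup>2" 1] by simp
  show ?thesis
    unfolding energy_def eq[symmetric]
    by (simp add: infsum_minus infsum_add sp infsum_cmult_right' summable_on_add summable_on_cmult_right
      sh sh')
qed

lemma energy_nonneg: "energy f \<ge> 0"
  unfolding energy_def by (rule infsum_nonneg) simp

text \<open>From \<open>(a - b)^2 <= 2 a^2 + 2 b^2\<close> and translation invariance. The constant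
  4 is exactly what the factor 1/4 in \<open>lazy_step\<close> can absorb.\<close>

lemma energy_le:
  assumes f: "finsupp f"
  shows "energy f \<le> 4 * (\<Sum>\<^sub>\<infinity>x. (f x)\<^sup>2)"
proof -
  note s = finsupp_intros f finsupp_shift[OF f] finsupp_shift_minus[OF f]
  have sp: "(\<lambda>x. (f x)\<^sup>2) summable_on UNIV" "(\<lambda>x. (f (x + 1))\<^sup>2) summable_on UNIV"
    by (intro finsupp_summable s)+
  have sh': "(\<Sum>\<^sub>\<infinity>x. (f (x + 1))\<^sup>2) = (\<Sum>\<^sub>\<infinity>x. (f x)\<^sup>2)"
    using infsum_shift[of "\<lambda>x. (f x)\<^sup>2" 1] by simp
  have "energy f \<le> (\<Sum>\<^sub>\<infinity>x. 2 * (f (x + 1))\<^sup>2 + 2 * (f x)\<^sup>2)"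
    unfolding energy_def
  proof (rule infsum_mono)
    show "(f (x + 1) - f x)\<^sup>2 \<le> 2 * (f (x + 1))\<^sup>2 + 2 * (f x)\<^sup>2" for x
      using zero_le_power2[of "f (x + 1) + f x"] by (simp add: power2_eq_square algebra_simps)
    show "(\<lambda>x. (f (x + 1) - f x)\<^sup>2) summable_on UNIV"
      "(\<lambda>x. 2 * (f (x + 1))\<^sup>2 + 2 * (f x)\<^sup>2) summable_on UNIV"
      by (intro finsupp_summable s)+
  qed
  also have "\<dots> = 4 * (\<Sum>\<^sub>\<infinity>x. (f x)\<^sup>2)"
    by (simp add: infsum_add sp infsum_cmult_right' summable_on_cmult_right sh')
  finally show ?thesis .
qed

text \<open>The path from \<open>0\<close> to \<open>x\<close> has \<open>\<bar>x\<bar>\<close> unit edges; each increment \<open>d\<close> is bounded by \<open>d\<^sup>2 / 8 + 2\<close>.\<close>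
lemma diff_le_energy:
  assumes f: "finsupp f"
  shows "f 0 - f x \<le> energy f / 8 + 2 * real_of_int \<bar>x\<bar>"
proof -
  have sp: "(\<lambda>x. (f (x + 1) - f x)\<^sup>2) summable_on UNIV"
    by (intro finsupp_summable finsupp_intros f finsupp_shift[OF f])
  have part: "(\<Sum>i\<in>F. (f (i + 1) - f i)\<^sup>2) \<le> energy f" if "finite F" for F
    unfolding energy_def by (rule finite_sum_le_infsum) (use sp that in auto)
  \<comment> \<open>The weight 1/8 is chosen with \<open>energy_green_le\<close> in view: an energy
    of at most \<open>4 u(0)\<close> then costs only half of \<open>u(0)\<close>, which can be
    absorbed.\<close>
  have inc: "\<bar>d\<bar> \<le> d\<^sup>2 / 8 + 2" for d :: real
    using zero_le_power2[of "\<bar>d\<bar> - 4"] by (simp add: power2_eq_square algebra_simps)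
  have tele: "\<bar>f (a + int n) - f a\<bar> \<le> (\<Sum>i\<in>{a..<a + int n}. \<bar>f (i + 1) - f i\<bar>)" for a n
  proof (induction n)
    case (Suc n)
    have "{a..<a + int (Suc n)} = insert (a + int n) {a..<a + int n}" by auto
    then show ?case using Suc by (simp add: algebra_simps)
  qed simp
  have main: "\<bar>f (a + int n) - f a\<bar> \<le> energy f / 8 + 2 * real n" for a n
  proof -
    have "\<bar>f (a + int n) - f a\<bar> \<le> (\<Sum>i\<in>{a..<a + int n}. (f (i + 1) - f i)\<^sup>2 / 8 + 2)"
      using tele[where a=a and n=n] sum_mono[of "{a..<a + int n}", OF inc] by (rule order_trans)
    also have "\<dots> = (\<Sum>i\<in>{a..<a + int n}. (f (i + 1) - f i)\<^sup>2) / 8 + 2 * real n"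
      by (simp add: sum.distrib sum_divide_distrib)
    also have "\<dots> \<le> energy f / 8 + 2 * real n"
      using part[of "{a..<a + int n}"] by simp
    finally show ?thesis .
  qed
  show ?thesis
  proof (cases "x \<ge> 0")
    case True
    then show ?thesis using main[of 0 "nat x"] by simp
  next
    case False
    then show ?thesis using main[of x "nat (- x)"] by simp
  qed
qed

definition vol :: "(int \<Rightarrow> real) \<Rightarrow> nat \<Rightarrow> real" where
  "vol \<tau> r = (\<Sum>x\<in>{- int r..int r}. \<tau> x)"

section \<open>Poisson weights and their moments\<close>

definition poisson_weight :: "real \<Rightarrow> nat \<Rightarrow> real" where
  "poisson_weight s n = exp (- s) * (s ^ n / fact n)"

lemma poisson_weight_nonneg: "s \<ge> 0 \<Longrightarrow> poisson_weight s n \<ge> 0"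
  by (simp add: poisson_weight_def)

text \<open>The recursion behind both moments below: multiplying or dividing by the index amounts to
  a shift of the weights.\<close>

lemma poisson_weight_Suc: "poisson_weight s (Suc n) * real (Suc n) = s * poisson_weight s n"
  by (simp add: poisson_weight_def divide_simps del: of_nat_Suc)

lemma poisson_weight_sums: "poisson_weight s sums 1"
proof -
  have "(\<lambda>n. s ^ n / fact n) sums exp s"
    using exp_converges[of s] by (simp add: field_simps)
  from sums_mult[OF this, of "exp (- s)"] show ?thesis
    by (simp add: poisson_weight_def[abs_def] exp_minus)
qed

lemma poisson_weight_mean_sums: "(\<lambda>n. poisson_weight s n * n) sums s"
proof -
  have "(\<lambda>n. poisson_weight s (Suc n) * real (Suc n)) sums s"
    using sums_mult[OF poisson_weight_sums[of s], of s] by (simp only: poisson_weight_Suc mult_1_right)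
  then show ?thesis by (subst (asm) sums_Suc_iff) simp
qed

text \<open>The shift loses the weight at 0, which is \<open>exp (- s)\<close>. This mean serves to
  average the term \<open>4 * \<rho> / (n + 1)\<close> of \<open>kern_0_le\<close>.\<close>

lemma poisson_weight_inverse_sums:
  assumes "s \<noteq> 0"
  shows "(\<lambda>n. poisson_weight s n / (real n + 1)) sums ((1 - exp (- s)) / s)"
proof -
  have "(\<lambda>n. poisson_weight s (Suc n)) sums (1 - exp (- s))"
    using poisson_weight_sums[of s] by (subst sums_Suc_iff) (simp add: poisson_weight_def)
  then have "(\<lambda>n. poisson_weight s (Suc n) / s) sums ((1 - exp (- s)) / s)"
    by (rule sums_divide)
  moreover have "poisson_weight s (Suc n) / s = poisson_weight s n / (real n + 1)" for n
    using poisson_weight_Suc[of s n] assms by (simp add: field_simps)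
  ultimately show ?thesis by simp
qed

section \<open>The lazy walk in a fixed environment\<close>

locale trap_environment =
  fixes \<tau> :: "int \<Rightarrow> real"
  assumes tau_ge_1: "\<tau> x \<ge> 1"
begin

lemma tau_pos: "\<tau> x > 0" and tau_nonzero: "\<tau> x \<noteq> 0"
  using tau_ge_1[of x] by linarith+

text \<open>The depths form the reversible measure of the walk, so the lazy step is self-adjoint for
  this pairing.\<close>

definition ip :: "(int \<Rightarrow> real) \<Rightarrow> (int \<Rightarrow> real) \<Rightarrow> real" where
  "ip f g = (\<Sum>\<^sub>\<infinity>x. f x * g x * \<tau> x)"

text \<open>The lazy walk \<open>I + L / 2\<close>. Laziness makes it positive semidefinite.\<close>
definition lazy_step :: "(int \<Rightarrow> real) \<Rightarrow> int \<Rightarrow> real" where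
  "lazy_step f x = f x + lap f x / (4 * \<tau> x)"

lemma finsupp_lazy_step: "finsupp f \<Longrightarrow> finsupp (lazy_step f)"
  unfolding lazy_step_def[abs_def] by (intro finsupp_intros finsupp_lap)

lemma ip_commute: "ip f g = ip g f"
  by (simp add: ip_def mult_ac)

lemma ip_add_left:
  assumes "finsupp f" "finsupp f'"
  shows "ip (\<lambda>x. f x + f' x) g = ip f g + ip f' g"
  unfolding ip_def distrib_right
  by (intro infsum_add finsupp_summable finsupp_mult_left assms)

lemma ip_diff_left:
  assumes "finsupp f" "finsupp f'"
  shows "ip (\<lambda>x. f x - f' x) g = ip f g - ip f' g"
  unfolding ip_def left_diff_distrib
  by (intro infsum_minus finsupp_summable finsupp_mult_left assms)

lemma ip_diff_right: "finsupp f \<Longrightarrow> finsupp f' \<Longrightarrow> ip g (\<lambda>x. f x - f' x) = ip g f - ip g f'"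
  using ip_diff_left[of f f' g] by (simp add: ip_commute)

text \<open>The weight in the pairing cancels the division by the depth in the step, leaving the
  plain Laplacian, which no longer sees the environment.\<close>

lemma ip_lazy_step_left:
  assumes f: "finsupp f"
  shows "ip (lazy_step f) g = ip f g + (\<Sum>\<^sub>\<infinity>x. f x * lap g x) / 4"
proof -
  note s = finsupp_summable finsupp_intros finsupp_lap f
  have "ip (lazy_step f) g = (\<Sum>\<^sub>\<infinity>x. f x * g x * \<tau> x + (lap f x * g x) * (1/4))"
    unfolding ip_def lazy_step_def
    by (intro infsum_cong) (use tau_nonzero in \<open>simp add: field_simps\<close>)
  also have "\<dots> = ip f g + (\<Sum>\<^sub>\<infinity>x. lap f x * g x * (1/4))"
    unfolding ip_def by (intro infsum_add s)
  also have "\<dots> = ip f g + (\<Sum>\<^sub>\<infinity>x. lap f x * g x) / 4"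
    by (subst infsum_cmult_left') simp
  finally show ?thesis by (simp add: infsum_lap_mult f)
qed

lemma ip_lazy_step_commute:
  assumes f: "finsupp f" and g: "finsupp g"
  shows "ip (lazy_step f) g = ip f (lazy_step g)"
proof -
  have "(\<Sum>\<^sub>\<infinity>x. f x * lap g x) = (\<Sum>\<^sub>\<infinity>x. g x * lap f x)"
    using infsum_lap_mult[OF f, of g] by (simp add: mult.commute)
  then show ?thesis
    by (simp add: ip_lazy_step_left[OF f, of g] ip_lazy_step_left[OF g, of f] ip_commute[of f])
qed

lemma ip_lazy_step_self: "finsupp f \<Longrightarrow> ip (lazy_step f) f = ip f f - energy f / 4"
  by (simp add: ip_lazy_step_left infsum_mult_lap_self)

text \<open>A quarter of the energy is at most the unweighted square norm, and depths of at least 1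
  bound that by the weighted one.\<close>

lemma ip_lazy_step_self_nonneg:
  assumes f: "finsupp f"
  shows "ip (lazy_step f) f \<ge> 0"
proof -
  have "energy f \<le> 4 * (\<Sum>\<^sub>\<infinity>x. (f x)\<^sup>2)" by (rule energy_le[OF f])
  also have "(\<Sum>\<^sub>\<infinity>x. (f x)\<^sup>2) \<le> ip f f" unfolding ip_def
  proof (rule infsum_mono)
    show "(f x)\<^sup>2 \<le> f x * f x * \<tau> x" for x
      using mult_left_mono[OF tau_ge_1[of x], of "(f x)\<^sup>2"] by (simp add: power2_eq_square)
  qed (intro finsupp_summable finsupp_intros f)+
  finally show ?thesis by (simp add: ip_lazy_step_self f)
qed

text \<open>Heat kernel of the lazy walk started at 0, as a density with respect to the depths. The
  step acts on functions of the starting point; by reversibility this gives the same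
  density.\<close>

definition kern :: "nat \<Rightarrow> int \<Rightarrow> real" where
  "kern n = (lazy_step ^^ n) (\<lambda>x. if x = 0 then 1 / \<tau> 0 else 0)"

lemma kern_Suc: "kern (Suc n) = lazy_step (kern n)"
  by (simp add: kern_def)

lemma finsupp_kern: "finsupp (kern n)"
proof (induction n)
  case 0
  show ?case by (simp add: kern_def finsupp_def)
qed (simp add: kern_Suc finsupp_lazy_step)

lemma kern_nonneg: "kern n x \<ge> 0"
proof (induction n arbitrary: x)
  case 0
  show ?case using tau_pos[of 0] by (simp add: kern_def)
next
  case (Suc n)
  have "kern (Suc n) x = kern n x * (1 - 1 / (2 * \<tau> x)) + (kern n (x + 1) + kern n (x - 1)) / (4 * \<tau> x)"
    using tau_nonzero[of x] by (simp add: kern_Suc lazy_step_def lap_def field_simps)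
  moreover have "1 / (2 * \<tau> x) \<le> 1"
    using tau_ge_1[of x] by (simp add: field_simps)
  ultimately show ?case
    using Suc tau_pos[of x] by (simp add: add_nonneg_nonneg)
qed

lemma ip_kern_0_left: "ip (kern 0) g = g 0"
proof -
  have "ip (kern 0) g = (\<Sum>\<^sub>\<infinity>x\<in>{0::int}. g 0)"
    unfolding ip_def by (rule infsum_cong_neutral) (auto simp: kern_def tau_nonzero)
  then show ?thesis by simp
qed

text \<open>Chapman-Kolmogorov: self-adjointness moves the steps one by one from the left factor to
  the right.\<close>

lemma ip_kern: "ip (kern m) (kern n) = kern (m + n) 0"
proof (induction m arbitrary: n)
  case 0
  show ?case by (simp add: ip_kern_0_left)
next
  case (Suc m)
  have "ip (kern (Suc m)) (kern n) = ip (kern m) (kern (Suc n))"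
    by (simp add: kern_Suc ip_lazy_step_commute finsupp_kern)
  then show ?case using Suc[of "Suc n"] by simp
qed

lemma kern_total: "ip (kern n) (\<lambda>_. 1) = 1"
proof (induction n)
  case (Suc n)
  then show ?case by (simp add: kern_Suc ip_lazy_step_left finsupp_kern) (simp add: lap_def)
qed (simp add: ip_kern_0_left)

text \<open>The lazy step \<open>A\<close> is self-adjoint with \<open>0 <= A <= I\<close>, so its
  return densities decrease. Half of the steps go to each side of the pairing: for even
  \<open>n\<close> the loss is a quarter of an energy, for odd \<open>n\<close> the positivity of
  \<open>A\<close> is needed too.\<close>

lemma kern_Suc_le: "kern (Suc n) 0 \<le> kern n 0"
proof -
  define m where "m = n div 2"
  let ?f = "kern m" and ?g = "kern (Suc m)"
  note fs = finsupp_kern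
  show ?thesis
  proof (cases "even n")
    case True
    then have "n = m + m" by (auto simp: m_def)
    then have "kern n 0 = ip ?f ?f" "kern (Suc n) 0 = ip (lazy_step ?f) ?f"
      using ip_kern[of m m] ip_kern[of "Suc m" m] by (simp_all add: kern_Suc)
    then show ?thesis using energy_nonneg[of ?f] by (simp add: ip_lazy_step_self fs)
  next
    case False
    then have n: "n = Suc m + m" by (auto simp: m_def elim: oddE)
    let ?d = "\<lambda>x. ?f x - ?g x"
    have step_d: "lazy_step ?d = (\<lambda>x. ?g x - lazy_step ?g x)"
      by (simp add: kern_Suc lazy_step_def[abs_def] lap_def fun_eq_iff algebra_simps diff_divide_distrib add_divide_distrib)
    \<comment> \<open>\<open>A (I - A) = (I - A) A (I - A) + A (I - A) A\<close>, a sum of two positive semidefinite operators\<close>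
    have "0 \<le> ip (lazy_step ?d) ?d"
      by (intro ip_lazy_step_self_nonneg finsupp_diff fs)
    also have "\<dots> = ip ?g ?f - ip ?g ?g - (ip (lazy_step ?g) ?f - ip (lazy_step ?g) ?g)"
      unfolding step_d by (simp add: ip_diff_left ip_diff_right fs finsupp_diff finsupp_lazy_step)
    also have "ip (lazy_step ?g) ?f = ip ?g ?g"
      by (simp only: ip_lazy_step_commute fs) (simp only: kern_Suc)
    finally have "0 \<le> ip ?g ?f - ip ?g ?g - (ip ?g ?g - ip (lazy_step ?g) ?g)" by simp
    moreover have "ip (lazy_step ?g) ?g \<le> ip ?g ?g"
      using energy_nonneg[of ?g] by (simp add: ip_lazy_step_self fs)
    moreover have "kern n 0 = ip ?g ?f" "kern (Suc n) 0 = ip ?g ?g"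
      using ip_kern[of "Suc m" m] ip_kern[of "Suc m" "Suc m"] n by simp_all
    ultimately show ?thesis by simp
  qed
qed

lemma kern_antimono: "m \<le> n \<Longrightarrow> kern n 0 \<le> kern m 0"
  by (rule lift_Suc_antimono_le[of "\<lambda>n. kern n 0"]) (rule kern_Suc_le)

lemma vol_pos: "vol \<tau> r > 0"
  unfolding vol_def by (rule sum_pos) (auto simp: tau_pos)

section \<open>Green function: density of the occupation time of the first \<open>N\<close>
  steps\<close>

definition green :: "nat \<Rightarrow> int \<Rightarrow> real" where
  "green N x = (\<Sum>n<N. kern n x)"

lemma finsupp_green: "finsupp (green N)"
  unfolding green_def[abs_def] by (intro finsupp_sum finsupp_kern)

lemma green_nonneg: "green N x \<ge> 0"
  unfolding green_def by (simp add: sum_nonneg kern_nonneg)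

lemma green_Suc: "green (Suc N) = (\<lambda>x. green N x + kern N x)"
  by (simp add: green_def fun_eq_iff)

text \<open>Poisson equation by telescoping: one more step drops the first kernel and gains the
  \<open>N\<close>-th.\<close>

lemma lazy_step_green: "lazy_step (green N) x = green N x - kern 0 x + kern N x"
proof (induction N)
  case 0
  show ?case by (simp add: green_def lazy_step_def lap_def)
next
  case (Suc N)
  have "lazy_step (green (Suc N)) x = lazy_step (green N) x + lazy_step (kern N) x"
    by (simp add: green_Suc lazy_step_def lap_def add_divide_distrib diff_divide_distrib algebra_simps)
  then show ?case using Suc by (simp add: kern_Suc green_Suc)
qed

lemma green_total: "ip (green N) (\<lambda>_. 1) = N"
proof (induction N)
  case 0
  show ?case by (simp add: green_def ip_def)
next
  case (Suc N)
  then show ?case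
    by (simp add: green_Suc ip_add_left finsupp_green finsupp_kern kern_total)
qed

text \<open>Pair the Poisson equation with the Green function itself. The unit source at 0 yields
  \<open>green N 0\<close>; the term with \<open>kern N\<close> has a favourable sign and is
  dropped.\<close>

lemma energy_green_le: "energy (green N) \<le> 4 * green N 0"
proof -
  note fs = finsupp_green finsupp_kern
  have "ip (lazy_step (green N)) (green N) = ip (\<lambda>x. green N x - kern 0 x + kern N x) (green N)"
    by (simp add: lazy_step_green[abs_def])
  also have "\<dots> = ip (green N) (green N) - green N 0 + ip (kern N) (green N)"
    by (simp add: ip_add_left ip_diff_left finsupp_diff fs ip_kern_0_left)
  finally have "energy (green N) / 4 = green N 0 - ip (kern N) (green N)"
    by (simp add: ip_lazy_step_self fs)
  moreover have "ip (kern N) (green N) \<ge> 0"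
    unfolding ip_def by (intro infsum_nonneg mult_nonneg_nonneg kern_nonneg green_nonneg less_imp_le tau_pos)
  ultimately show ?thesis by simp
qed

text \<open>By \<open>diff_le_energy\<close> and \<open>energy_green_le\<close> the Green function
  is at least \<open>green N 0 / 2 - 2 * \<rho>\<close> on the whole ball, while its total mass is
  only \<open>N\<close>.\<close>

lemma green_0_le: "green N 0 \<le> 2 * N / vol \<tau> \<rho> + 4 * \<rho>"
proof -
  let ?B = "{- int \<rho>..int \<rho>}"
  have le: "green N 0 / 2 - 2 * \<rho> \<le> green N x" if "x \<in> ?B" for x
  proof -
    have "real_of_int \<bar>x\<bar> \<le> \<rho>" using that by auto
    then show ?thesis
      using diff_le_energy[OF finsupp_green, of N x] energy_green_le[of N] by simp
  qed
  have "(green N 0 / 2 - 2 * \<rho>) * vol \<tau> \<rho> = (\<Sum>x\<in>?B. (green N 0 / 2 - 2 * \<rho>) * \<tau> x)"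
    by (simp add: vol_def sum_distrib_left)
  also have "\<dots> \<le> (\<Sum>x\<in>?B. green N x * 1 * \<tau> x)"
    using le tau_pos by (intro sum_mono) (simp add: mult_right_mono less_imp_le)
  also have "\<dots> \<le> ip (green N) (\<lambda>_. 1)"
    unfolding ip_def
    by (intro finite_sum_le_infsum finsupp_summable finsupp_intros finsupp_green)
      (auto simp: green_nonneg tau_pos less_imp_le)
  also have "\<dots> = N" by (rule green_total)
  finally have "green N 0 / 2 - 2 * \<rho> \<le> N / vol \<tau> \<rho>"
    using vol_pos[of \<rho>] by (simp add: pos_le_divide_eq)
  then show ?thesis by simp
qed

text \<open>By monotonicity the \<open>n\<close>-th value is at most the average of the first
  \<open>n + 1\<close> values, which is the Green function at 0 divided by
  \<open>n + 1\<close>.\<close>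

lemma kern_0_le: "kern n 0 \<le> 2 / vol \<tau> \<rho> + 4 * \<rho> / (n + 1)"
proof -
  have "real (n + 1) * kern n 0 = (\<Sum>k<n + 1. kern n 0)" by simp
  also have "\<dots> \<le> green (n + 1) 0"
    unfolding green_def by (intro sum_mono kern_antimono) auto
  also have "\<dots> \<le> 2 * real (n + 1) / vol \<tau> \<rho> + 4 * \<rho>"
    using green_0_le[of "n + 1" \<rho>] by simp
  finally have "kern n 0 \<le> (2 * real (n + 1) / vol \<tau> \<rho> + 4 * \<rho>) / real (n + 1)"
    by (simp add: pos_le_divide_eq mult.commute)
  also have "\<dots> = 2 / vol \<tau> \<rho> + 4 * \<rho> / real (n + 1)"
    using vol_pos[of \<rho>] by (simp add: divide_simps)
  finally show ?thesis by (simp add: add.commute)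
qed

text \<open>Testing against a tent shows that mass at least 1/2 stays in the ball after
  \<open>N\<close> steps; Cauchy-Schwarz turns this into a bound on the squared norm of
  \<open>kern N\<close>, which is \<open>kern (2 * N) 0\<close>.\<close>

lemma kern_double_ge:
  assumes r: "real r \<ge> green N 0" "r > 0"
  shows "kern (2 * N) 0 \<ge> 1 / (4 * vol \<tau> r)"
proof -
  let ?B = "{- int r..int r}"
  define g :: "int \<Rightarrow> real" where "g x = max 0 (1 - real_of_int \<bar>x\<bar> / r)" for x
  have g01: "0 \<le> g x" "g x \<le> 1" for x using r by (auto simp: g_def)
  have g_supp: "g x = 0" if "x \<notin> ?B" for x
    using that r by (auto simp: g_def field_simps)
  \<comment> \<open>The tent is convex away from its peak, including the kinks where it reaches 0,
    so only the peak contributes negatively.\<close>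
  have lap_g: "lap g x \<ge> (if x = 0 then - 2 / r else 0)" for x
  proof -
    consider "x = 0" | "x \<ge> 1" | "x \<le> - 1" by linarith
    then show ?thesis
    proof cases
      case 1 then show ?thesis using r by (simp add: lap_def g_def max_def)
    next
      case 2
      then have "g (x + 1) \<ge> 1 - (real_of_int x + 1) / r" "g (x - 1) \<ge> 1 - (real_of_int x - 1) / r"
        by (simp_all add: g_def)
      then have "g (x + 1) + g (x - 1) \<ge> 2 * (1 - real_of_int x / r)"
        by (simp add: diff_divide_distrib add_divide_distrib)
      then show ?thesis using 2 g01(1)[of "x + 1"] g01(1)[of "x - 1"]
        by (auto simp: lap_def g_def[of x] max_def)
    next
      case 3
      then have "g (x + 1) \<ge> 1 - (- real_of_int x - 1) / r" "g (x - 1) \<ge> 1 - (- real_of_int x + 1) / r"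
        by (simp_all add: g_def)
      then have "g (x + 1) + g (x - 1) \<ge> 2 * (1 + real_of_int x / r)"
        by (simp add: diff_divide_distrib add_divide_distrib)
      then show ?thesis using 3 g01(1)[of "x + 1"] g01(1)[of "x - 1"]
        by (auto simp: lap_def g_def[of x] max_def)
    qed
  qed
  \<comment> \<open>Each step costs at most \<open>kern N 0 / (2 * r)\<close>; the costs add up to
    the Green function at 0.\<close>
  have "ip (kern N) g \<ge> 1 - green N 0 / (2 * r)"
  proof (induction N)
    case 0
    show ?case by (simp add: ip_kern_0_left green_def g_def)
  next
    case (Suc N)
    have "- 2 / r * kern N 0 = (\<Sum>\<^sub>\<infinity>x\<in>{0::int}. kern N 0 * (- 2 / r))" by simp
    also have "\<dots> = (\<Sum>\<^sub>\<infinity>x. kern N x * (if x = 0 then - 2 / r else 0))"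
      by (rule infsum_cong_neutral) auto
    also have "\<dots> \<le> (\<Sum>\<^sub>\<infinity>x. kern N x * lap g x)"
      by (intro infsum_mono finsupp_summable finsupp_intros finsupp_kern mult_left_mono lap_g kern_nonneg)
    finally have "ip (kern (Suc N)) g \<ge> ip (kern N) g - kern N 0 / (2 * r)"
      by (simp add: kern_Suc ip_lazy_step_left finsupp_kern)
    then show ?case using Suc by (simp add: green_Suc add_divide_distrib)
  qed
  moreover have "green N 0 / (2 * r) \<le> 1 / 2" using r by (simp add: field_simps)
  ultimately have "1 / 2 \<le> ip (kern N) g" by simp
  \<comment> \<open>Cauchy--Schwarz for \<open>kern N\<close> and the indicator of the ball, in the form \<open>a \<le> v a\<^sup>2 + 1 / (4 v)\<close>\<close>
  also have "\<dots> = (\<Sum>\<^sub>\<infinity>x\<in>?B. kern N x * g x * \<tau> x)"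
    unfolding ip_def by (rule infsum_cong_neutral) (use g_supp in auto)
  also have "\<dots> = (\<Sum>x\<in>?B. kern N x * g x * \<tau> x)" by simp
  also have "\<dots> \<le> (\<Sum>x\<in>?B. vol \<tau> r * (kern N x * kern N x * \<tau> x) + \<tau> x / (4 * vol \<tau> r))"
  proof (rule sum_mono)
    fix x
    have "0 \<le> (2 * vol \<tau> r * kern N x - 1)\<^sup>2 / (4 * vol \<tau> r)"
      using vol_pos[of r] by simp
    also have "\<dots> = vol \<tau> r * kern N x * kern N x - kern N x + 1 / (4 * vol \<tau> r)"
      using vol_pos[of r] by (simp add: power2_eq_square field_simps)
    finally have "kern N x \<le> vol \<tau> r * kern N x * kern N x + 1 / (4 * vol \<tau> r)" by simp
    moreover have "kern N x * g x \<le> kern N x"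
      using kern_nonneg[of N x] g01 by (simp add: mult_left_le)
    ultimately have "kern N x * g x * \<tau> x \<le> (vol \<tau> r * kern N x * kern N x + 1 / (4 * vol \<tau> r)) * \<tau> x"
      using tau_pos[of x] by (intro mult_right_mono) auto
    then show "kern N x * g x * \<tau> x \<le> vol \<tau> r * (kern N x * kern N x * \<tau> x) + \<tau> x / (4 * vol \<tau> r)"
      by (simp add: algebra_simps)
  qed
  also have "\<dots> = vol \<tau> r * (\<Sum>x\<in>?B. kern N x * kern N x * \<tau> x) + vol \<tau> r / (4 * vol \<tau> r)"
    by (simp only: sum.distrib sum_distrib_left sum_divide_distrib vol_def)
  also have "\<dots> \<le> vol \<tau> r * ip (kern N) (kern N) + 1 / 4"
  proof -
    have "(\<Sum>x\<in>?B. kern N x * kern N x * \<tau> x) \<le> ip (kern N) (kern N)"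
      unfolding ip_def
      by (intro finite_sum_le_infsum finsupp_summable finsupp_intros finsupp_kern)
        (auto simp: tau_pos less_imp_le)
    then show ?thesis using vol_pos[of r] by simp
  qed
  finally have "1 / 4 \<le> vol \<tau> r * kern (2 * N) 0"
    by (simp add: ip_kern mult_2)
  then show ?thesis using vol_pos[of r] by (simp add: field_simps)
qed

section \<open>From powers of the generator to the lazy walk at a Poisson time\<close>

definition gen :: "(int \<Rightarrow> real) \<Rightarrow> int \<Rightarrow> real" where
  "gen f x = lap f x / (2 * \<tau> x)"

lemma gen_pow_eq: "gen_pow \<tau> n x y = (gen ^^ n) (\<lambda>x. if x = y then 1 else 0) x"
proof (induction n arbitrary: x)
  case (Suc n)
  have "{x - 1..x + 1} = {x - 1, x, x + 1}" by auto
  then show ?case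
    by (simp add: Suc bouchaud_gen_def gen_def lap_def add_divide_distrib diff_divide_distrib)
qed simp

text \<open>Depths of at least 1 bound the generator by 2 in the supremum norm, which makes the
  exponential series absolutely convergent.\<close>

lemma gen_pow_bound: "\<bar>gen_pow \<tau> n x y\<bar> \<le> 2 ^ n"
proof (induction n arbitrary: x)
  case (Suc n)
  let ?f = "\<lambda>x. gen_pow \<tau> n x y"
  have "{x - 1..x + 1} = {x - 1, x, x + 1}" by auto
  then have "gen_pow \<tau> (Suc n) x y = (?f (x + 1) + ?f (x - 1) - 2 * ?f x) / (2 * \<tau> x)"
    by (simp add: bouchaud_gen_def add_divide_distrib diff_divide_distrib)
  also have "\<bar>\<dots>\<bar> \<le> \<bar>?f (x + 1) + ?f (x - 1) - 2 * ?f x\<bar> / 2"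
    using tau_ge_1[of x] unfolding abs_divide by (intro divide_left_mono) auto
  also have "\<dots> \<le> 2 ^ Suc n"
    using Suc[of "x + 1"] Suc[of "x - 1"] Suc[of x] by simp
  finally show ?case .
qed simp

text \<open>The binomial expansion of \<open>(I + L / 2)^n\<close>, proved through Pascal's
  rule.\<close>

lemma kern_eq_sum_gen_pow:
  "kern n x = (\<Sum>k\<le>n. real (n choose k) * gen_pow \<tau> k x 0 / 2 ^ k) / \<tau> 0"
proof (induction n arbitrary: x)
  case 0
  show ?case by (simp add: kern_def)
next
  case (Suc n)
  let ?c = "\<lambda>n k x. real (n choose k) * gen_pow \<tau> k x 0 / 2 ^ k"
  have gp: "gen_pow \<tau> (Suc k) x 0 = lap (\<lambda>x. gen_pow \<tau> k x 0) x / (2 * \<tau> x)" for k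
    unfolding gen_pow_eq[abs_def] by (simp add: gen_def)
  have lin: "lap (\<lambda>x. (\<Sum>k\<le>n. ?c n k x) / \<tau> 0) x
      = (\<Sum>k\<le>n. real (n choose k) * lap (\<lambda>x. gen_pow \<tau> k x 0) x / 2 ^ k) / \<tau> 0"
    by (simp add: lap_def sum_divide_distrib sum_distrib_left sum.distrib sum_subtractf
        algebra_simps add_divide_distrib diff_divide_distrib)
  have "kern (Suc n) x = (\<Sum>k\<le>n. ?c n k x) / \<tau> 0
      + (\<Sum>k\<le>n. real (n choose k) * lap (\<lambda>x. gen_pow \<tau> k x 0) x / 2 ^ k) / \<tau> 0 / (4 * \<tau> x)"
    unfolding kern_Suc lazy_step_def Suc[abs_def] lin ..
  also have "\<dots> = ((\<Sum>k\<le>n. ?c n k x)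
      + (\<Sum>k\<le>n. real (n choose k) * gen_pow \<tau> (Suc k) x 0 / 2 ^ Suc k)) / \<tau> 0"
    unfolding gp by (simp add: sum_divide_distrib add_divide_distrib mult_ac)
  also have "(\<Sum>k\<le>n. ?c n k x) + (\<Sum>k\<le>n. real (n choose k) * gen_pow \<tau> (Suc k) x 0 / 2 ^ Suc k)
      = (\<Sum>k\<le>Suc n. ?c (Suc n) k x)"
  proof -
    \<comment> \<open>The added term vanishes because \<open>n choose Suc n\<close> is 0; both sums
      then have the same range and their terms with \<open>k = 0\<close> can be split off.\<close>
    have "(\<Sum>k\<le>n. ?c n k x) = (\<Sum>k\<le>Suc n. ?c n k x)" by simp
    also have "\<dots> = gen_pow \<tau> 0 x 0
        + (\<Sum>k\<le>n. real (n choose Suc k) * gen_pow \<tau> (Suc k) x 0 / 2 ^ Suc k)"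
      by (subst sum.atMost_Suc_shift) simp
    moreover have "(\<Sum>k\<le>Suc n. ?c (Suc n) k x) = gen_pow \<tau> 0 x 0
        + (\<Sum>k\<le>n. real (Suc n choose Suc k) * gen_pow \<tau> (Suc k) x 0 / 2 ^ Suc k)"
      by (subst sum.atMost_Suc_shift) simp
    ultimately show ?thesis
      by (simp only: binomial_Suc_Suc of_nat_add distrib_right add_divide_distrib sum.distrib)
  qed
  finally show ?case .
qed

lemma abs_summable_exp_gen_pow:
  "summable (\<lambda>n. norm (t ^ n / fact n * gen_pow \<tau> n x y))"
proof (rule summable_comparison_test')
  show "summable (\<lambda>n. (2 * \<bar>t\<bar>) ^ n / fact n)"
    using summable_exp_generic[of "2 * \<bar>t\<bar>"] by (simp add: field_simps)
  show "norm (norm (t ^ n / fact n * gen_pow \<tau> n x y)) \<le> (2 * \<bar>t\<bar>) ^ n / fact n" for n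
    using mult_left_mono[OF gen_pow_bound[of n x y], of "\<bar>t\<bar> ^ n / fact n"]
    by (simp add: abs_mult abs_divide power_abs power_mult_distrib mult_ac)
qed

text \<open>Uniformisation: \<open>exp (t L) = exp (- 2 t) exp (2 t A)\<close> for the lazy walk \<open>A = I + L / 2\<close>.\<close>
lemma heat_kernel_uniformised:
  "(\<lambda>n. poisson_weight (2 * t) n * kern n 0) sums heat_kernel \<tau> t 0 0"
proof -
  let ?a = "\<lambda>k. t ^ k / fact k * gen_pow \<tau> k 0 0" and ?b = "\<lambda>k. (2 * t) ^ k / fact k"
  \<comment> \<open>Since \<open>2 t A = t L + 2 t I\<close>, the series of
    \<open>exp (2 t A)\<close> is the Cauchy product of those of \<open>exp (t L)\<close> and
    \<open>exp (2 t)\<close>.\<close>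
  have "(\<lambda>n. \<Sum>k\<le>n. ?a k * ?b (n - k)) sums ((\<Sum>k. ?a k) * (\<Sum>k. ?b k))"
  proof (rule Cauchy_product_sums[OF abs_summable_exp_gen_pow])
    show "summable (\<lambda>k. norm (?b k))"
      using summable_norm_exp[of "2 * t"] by (simp add: field_simps)
  qed
  moreover have "(\<Sum>k. ?b k) = exp (2 * t)"
    by (simp add: exp_def field_simps)
  moreover have "(\<Sum>k\<le>n. ?a k * ?b (n - k)) = (2 * t) ^ n / fact n * (kern n 0 * \<tau> 0)" for n
  proof -
    have "?a k * ?b (n - k) = (2 * t) ^ n / fact n * (real (n choose k) * gen_pow \<tau> k 0 0 / 2 ^ k)"
      if "k \<le> n" for k
    proof -
      have "(2 * t) ^ n = (2 * t) ^ k * (2 * t) ^ (n - k)"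
        using that by (simp only: power_add[symmetric]) simp
      then have "(2 * t) ^ n / 2 ^ k = t ^ k * (2 * t) ^ (n - k)"
        by (simp add: power_mult_distrib)
      moreover have "real (n choose k) / fact n = 1 / (fact k * fact (n - k))"
        using that by (simp add: binomial_fact)
      ultimately have "((2 * t) ^ n / 2 ^ k) * (real (n choose k) / fact n) * gen_pow \<tau> k 0 0
          = t ^ k * (2 * t) ^ (n - k) * (1 / (fact k * fact (n - k))) * gen_pow \<tau> k 0 0"
        by simp
      then show ?thesis by (simp add: mult_ac)
    qed
    then have "(\<Sum>k\<le>n. ?a k * ?b (n - k))
        = (2 * t) ^ n / fact n * (\<Sum>k\<le>n. real (n choose k) * gen_pow \<tau> k 0 0 / 2 ^ k)"
      by (simp add: sum_distrib_left)
    then show ?thesis by (simp add: kern_eq_sum_gen_pow tau_nonzero)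
  qed
  ultimately have "(\<lambda>n. (2 * t) ^ n / fact n * (kern n 0 * \<tau> 0)) sums (trans_prob \<tau> t 0 0 * exp (2 * t))"
    by (simp add: trans_prob_def)
  from sums_mult[OF this, of "exp (- 2 * t) / \<tau> 0"] show ?thesis
    by (simp add: heat_kernel_def poisson_weight_def tau_nonzero exp_minus field_simps)
qed

text \<open>Average \<open>kern_0_le\<close> over a Poisson number of steps with mean
  \<open>2 * t\<close>: the mean of \<open>1 / (n + 1)\<close> is at most
  \<open>1 / (2 * t)\<close>.\<close>

lemma heat_kernel_upper:
  assumes t: "t > 0"
  shows "heat_kernel \<tau> t 0 0 \<le> 2 / vol \<tau> \<rho> + 2 * \<rho> / t"
proof -
  let ?w = "poisson_weight (2 * t)"
  have w: "?w n \<ge> 0" for n using t by (intro poisson_weight_nonneg) simp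
  have t2: "2 * t \<noteq> 0" using t by simp
  have "?w n * kern n 0 \<le> 2 / vol \<tau> \<rho> * ?w n + 4 * real \<rho> * (?w n / (real n + 1))" for n
    using mult_left_mono[OF kern_0_le[of n \<rho>], of "?w n"] w[of n] by (simp add: algebra_simps)
  moreover have "(\<lambda>n. 2 / vol \<tau> \<rho> * ?w n + 4 * real \<rho> * (?w n / (real n + 1)))
      sums (2 / vol \<tau> \<rho> * 1 + 4 * real \<rho> * ((1 - exp (- (2 * t))) / (2 * t)))"
    by (intro sums_add sums_mult poisson_weight_sums poisson_weight_inverse_sums[OF t2])
  ultimately have "heat_kernel \<tau> t 0 0
      \<le> 2 / vol \<tau> \<rho> * 1 + 4 * real \<rho> * ((1 - exp (- (2 * t))) / (2 * t))"
    by (rule sums_le[OF _ heat_kernel_uniformised])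
  also have "\<dots> \<le> 2 / vol \<tau> \<rho> * 1 + 4 * real \<rho> * (1 / (2 * t))"
    using t by (intro add_left_mono mult_left_mono divide_right_mono) auto
  finally show ?thesis using t by simp
qed

text \<open>The condition on \<open>r\<close> and \<open>green_0_le\<close> give
  \<open>green N 0 <= r\<close> for \<open>N\<close> about \<open>2 * t\<close>, so
  \<open>kern_double_ge\<close> applies. Comparing the Poisson clock with \<open>2 * N\<close> steps
  costs another factor 2.\<close>

lemma heat_kernel_lower:
  assumes t: "t > 0" and r: "r > 0" "real r \<ge> 2 * (2 * t + 1) / vol \<tau> \<rho> + 4 * real \<rho>"
  shows "heat_kernel \<tau> t 0 0 \<ge> 1 / (8 * vol \<tau> r)"
proof -
  let ?w = "poisson_weight (2 * t)"
  have w: "?w n \<ge> 0" for n using t by (intro poisson_weight_nonneg) simp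
  \<comment> \<open>Rounding up keeps the Poisson mean below \<open>N\<close>, while
    \<open>N <= 2 * t + 1\<close> matches the condition on \<open>r\<close>.\<close>
  define N where "N = nat \<lceil>2 * t\<rceil>"
  have N: "2 * t \<le> N" "N \<le> 2 * t + 1" "N > 0"
    using t by (auto simp: N_def)
  have "2 * real N / vol \<tau> \<rho> \<le> 2 * (2 * t + 1) / vol \<tau> \<rho>"
    using N vol_pos[of \<rho>] by (intro divide_right_mono) auto
  then have "green N 0 \<le> r" using green_0_le[of N \<rho>] r by simp
  then have q: "1 / (4 * vol \<tau> r) \<le> kern (2 * N) 0"
    using r by (intro kern_double_ge)
  \<comment> \<open>Markov's inequality for the Poisson number of steps, whose mean is at most \<open>N\<close>\<close>
  have ge: "kern (2 * N) 0 * (1 - n / (2 * N)) \<le> kern n 0" for n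
  proof (cases "n \<le> 2 * N")
    case True
    have "kern (2 * N) 0 * (1 - n / (2 * N)) \<le> kern (2 * N) 0"
      using kern_nonneg[of "2 * N" 0] by (intro mult_left_le) auto
    also have "\<dots> \<le> kern n 0" by (rule kern_antimono[OF True])
    finally show ?thesis .
  next
    case False
    then have "1 - n / (2 * N) \<le> 0" using N by (simp add: field_simps)
    then show ?thesis
      using kern_nonneg[of "2 * N" 0] kern_nonneg[of n 0] mult_nonneg_nonpos by (meson order_trans)
  qed
  have "kern (2 * N) 0 * (?w n - ?w n * n / (2 * N)) \<le> ?w n * kern n 0" for n
    using mult_left_mono[OF ge[of n], of "?w n"] w[of n] by (simp add: algebra_simps)
  moreover have "(\<lambda>n. kern (2 * N) 0 * (?w n - ?w n * n / (2 * N)))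
      sums (kern (2 * N) 0 * (1 - 2 * t / (2 * N)))"
    by (intro sums_mult sums_diff sums_divide poisson_weight_sums poisson_weight_mean_sums)
  ultimately have "kern (2 * N) 0 * (1 - 2 * t / (2 * N)) \<le> heat_kernel \<tau> t 0 0"
    by (rule sums_le[OF _ _ heat_kernel_uniformised])
  moreover have "1 / 2 \<le> 1 - 2 * t / (2 * N)" using N t by (simp add: field_simps)
  ultimately have "kern (2 * N) 0 * (1 / 2) \<le> heat_kernel \<tau> t 0 0"
    using kern_nonneg[of "2 * N" 0] by (meson mult_left_mono order_trans)
  then show ?thesis using q by simp
qed

end

section \<open>The volume of a ball in the random environment\<close>

text \<open>Closed form of 1 plus the integral of \<open>u powr - \<alpha>\<close> over
  \<open>[1, T]\<close>; \<open>expectation_min\<close> identifies it with the mean of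
  \<open>min \<tau> T\<close>. The case \<alpha> = 1 is logarithmic.\<close>

definition truncated_mean :: "real \<Rightarrow> real \<Rightarrow> real" where
  "truncated_mean \<alpha> T = 1 + (if \<alpha> = 1 then ln T else (T powr (1 - \<alpha>) - 1) / (1 - \<alpha>))"

lemma truncated_mean_ge_1:
  assumes "T \<ge> 1"
  shows "truncated_mean \<alpha> T \<ge> 1"
proof -
  consider "\<alpha> = 1" | "\<alpha> < 1" | "\<alpha> > 1" by linarith
  then show ?thesis
  proof cases
    case 2
    then have "T powr (1 - \<alpha>) \<ge> 1" using assms by (simp add: ge_one_powr_ge_zero)
    then show ?thesis using 2 by (simp add: truncated_mean_def)
  next
    case 3
    then have "T powr (1 - \<alpha>) \<le> 1" using assms powr_mono[of "1 - \<alpha>" 0 T] by simp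
    then show ?thesis using 3 by (simp add: truncated_mean_def divide_nonpos_neg)
  qed (use assms in \<open>simp add: truncated_mean_def\<close>)
qed

lemma nn_integral_powr_Icc:
  assumes "T \<ge> 1"
  shows "(\<integral>\<^sup>+u\<in>{1..T}. ennreal (u powr - \<alpha>) \<partial>lborel) = ennreal (truncated_mean \<alpha> T - 1)"
proof -
  define F where "F u = (if \<alpha> = 1 then ln u else u powr (1 - \<alpha>) / (1 - \<alpha>))" for u :: real
  have "(\<integral>\<^sup>+u\<in>{1..T}. ennreal (u powr - \<alpha>) \<partial>lborel) = ennreal (F T - F 1)"
  proof (rule nn_integral_FTC_Icc)
    fix u :: real assume "u \<in> {1..T}"
    then have u: "u \<ge> 1" by simp
    show "(F has_real_derivative u powr - \<alpha>) (at u)"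
    proof (cases "\<alpha> = 1")
      case True
      then show ?thesis unfolding F_def[abs_def] using u
        by (auto intro!: derivative_eq_intros simp: powr_minus_divide)
    next
      case False
      have "((\<lambda>u. u powr (1 - \<alpha>) / (1 - \<alpha>)) has_real_derivative u powr - \<alpha>) (at u)"
        using u False by (auto intro!: derivative_eq_intros)
      then show ?thesis unfolding F_def[abs_def] using False by simp
    qed
  qed (use assms in auto)
  also have "F T - F 1 = truncated_mean \<alpha> T - 1"
    by (simp add: F_def truncated_mean_def diff_divide_distrib)
  finally show ?thesis .
qed

text \<open>From \<open>exp (- y) <= 1 / (1 + y)\<close>. The cutoff at 1 lets truncated means
  control Laplace transforms even when the depths have infinite mean.\<close>

lemma exp_minus_le:
  assumes "y \<ge> (0::real)"
  shows "exp (- y) \<le> 1 - min y 1 / 2"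
proof (cases "y \<le> 1")
  case True
  have "exp (- y) \<le> 1 / (1 + y)"
    using assms exp_ge_add_one_self[of y] by (simp add: exp_minus field_simps)
  also have "\<dots> \<le> 1 - y / 2"
    using assms True mult_left_mono[OF True assms] by (simp add: field_simps)
  finally show ?thesis using True by simp
next
  case False
  have "exp (- y) \<le> 1 / (1 + y)"
    using assms exp_ge_add_one_self[of y] by (simp add: exp_minus field_simps)
  also have "\<dots> \<le> 1 / 2" using False by (simp add: field_simps)
  finally show ?thesis using False by simp
qed

section \<open>The random environment: truncated moments and deviations of the volume\<close>

locale random_traps = prob_space M for M :: "'a measure" +
  fixes tau :: "int \<Rightarrow> 'a \<Rightarrow> real" and \<alpha> :: real
  assumes alpha_pos: "\<alpha> > 0"
    and indep: "indep_vars (\<lambda>_. borel) tau UNIV"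
    and tail: "u \<ge> 1 \<Longrightarrow> prob {\<omega> \<in> space M. tau x \<omega> > u} = u powr (- \<alpha>)"
begin

lemma tau_measurable [measurable]: "tau x \<in> borel_measurable M"
  using indep by (auto simp: indep_vars_def)

lemma AE_tau_gt_1: "AE \<omega> in M. \<forall>x. tau x \<omega> > 1"
proof (subst AE_all_countable, rule allI)
  fix x
  have "prob {\<omega> \<in> space M. tau x \<omega> > 1} = 1" using tail[of 1 x] by simp
  then show "AE \<omega> in M. tau x \<omega> > 1" by (simp add: prob_Collect_eq_1)
qed

lemma AE_tau_gt: "AE \<omega> in M. tau x \<omega> > 1"
  using AE_tau_gt_1 by eventually_elim blast

lemma integrable_min: "integrable M (\<lambda>\<omega>. min (tau x \<omega>) T)"
proof (rule integrable_const_bound[where B="max 1 \<bar>T\<bar>"])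
  show "AE \<omega> in M. norm (min (tau x \<omega>) T) \<le> max 1 \<bar>T\<bar>"
    using AE_tau_gt[of x] by eventually_elim auto
qed measurable

text \<open>The layer cake formula \<open>min \<tau> T = 1 + \<integral>\<^bsub>1\<^esub>\<^bsup>T\<^esup> 1[\<tau> > u] du\<close>.\<close>
lemma expectation_min:
  assumes T: "T \<ge> 1"
  shows "expectation (\<lambda>\<omega>. min (tau x \<omega>) T) = truncated_mean \<alpha> T"
proof -
  interpret L: pair_sigma_finite M lborel by standard
  let ?g = "\<lambda>(\<omega>, u). indicator {1..T} u * (indicator {u. u < tau x \<omega>} u) :: ennreal"
  have [measurable]: "?g \<in> borel_measurable (M \<Otimes>\<^sub>M lborel)" by measurable
  have inner: "(\<integral>\<^sup>+u. ?g (\<omega>, u) \<partial>lborel) = ennreal (min (tau x \<omega>) T - 1)" if "tau x \<omega> > 1" for \<omega>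
  proof -
    have "?g (\<omega>, u) = indicator ({1..T} \<inter> {..<tau x \<omega>}) u" for u
      by (auto split: split_indicator)
    then have "(\<integral>\<^sup>+u. ?g (\<omega>, u) \<partial>lborel) = emeasure lborel ({1..T} \<inter> {..<tau x \<omega>})"
      by simp
    also have "\<dots> = ennreal (min (tau x \<omega>) T - 1)"
    proof (cases "tau x \<omega> \<le> T")
      case True
      then have "{1..T} \<inter> {..<tau x \<omega>} = {1..<tau x \<omega>}" by auto
      then show ?thesis using True that by simp
    next
      case False
      then have "{1..T} \<inter> {..<tau x \<omega>} = {1..T}" by auto
      then show ?thesis using False T by simp
    qed
    finally show ?thesis .
  qed
  have "(\<integral>\<^sup>+\<omega>. ennreal (min (tau x \<omega>) T - 1) \<partial>M) = (\<integral>\<^sup>+\<omega>. \<integral>\<^sup>+u. ?g (\<omega>, u) \<partial>lborel \<partial>M)"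
    by (intro nn_integral_cong_AE) (use AE_tau_gt[of x] in eventually_elim, simp only: inner)
  also have "\<dots> = (\<integral>\<^sup>+u. \<integral>\<^sup>+\<omega>. ?g (\<omega>, u) \<partial>M \<partial>lborel)"
    by (rule L.Fubini[symmetric]) measurable
  also have "\<dots> = (\<integral>\<^sup>+u\<in>{1..T}. ennreal (u powr - \<alpha>) \<partial>lborel)"
  proof (rule nn_integral_cong)
    fix u :: real
    show "(\<integral>\<^sup>+\<omega>. ?g (\<omega>, u) \<partial>M) = ennreal (u powr - \<alpha>) * indicator {1..T} u"
    proof (cases "u \<in> {1..T}")
      case True
      then have "(\<integral>\<^sup>+\<omega>. ?g (\<omega>, u) \<partial>M) = (\<integral>\<^sup>+\<omega>. indicator {\<omega> \<in> space M. tau x \<omega> > u} \<omega> \<partial>M)"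
        by (intro nn_integral_cong) (auto split: split_indicator)
      also have "\<dots> = emeasure M {\<omega> \<in> space M. tau x \<omega> > u}" by simp
      also have "\<dots> = ennreal (u powr - \<alpha>)"
        using True by (simp add: emeasure_eq_measure tail)
      finally show ?thesis using True by simp
    qed simp
  qed
  also have "\<dots> = ennreal (truncated_mean \<alpha> T - 1)" by (rule nn_integral_powr_Icc[OF T])
  finally have "(\<integral>\<^sup>+\<omega>. ennreal (min (tau x \<omega>) T - 1) \<partial>M) = ennreal (truncated_mean \<alpha> T - 1)" .
  then have "expectation (\<lambda>\<omega>. min (tau x \<omega>) T - 1) = truncated_mean \<alpha> T - 1"
  proof (intro integral_eq_nn_integral[THEN trans])
    show "AE \<omega> in M. 0 \<le> min (tau x \<omega>) T - 1"
      using AE_tau_gt[of x] by eventually_elim (use T in \<open>auto simp: less_imp_le\<close>)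
  qed (use truncated_mean_ge_1[OF T, of \<alpha>] in auto)
  then show ?thesis by (simp add: integrable_min prob_space)
qed

text \<open>The cutoff of \<open>exp_minus_le\<close> at \<open>\<theta> * \<tau> = 1\<close> is
  truncation of the depth at \<open>1 / \<theta>\<close>; then
  \<open>1 - z <= exp (- z)\<close>.\<close>

lemma expectation_exp_le:
  assumes \<theta>: "0 < \<theta>" "\<theta> \<le> 1"
  shows "expectation (\<lambda>\<omega>. exp (- \<theta> * tau x \<omega>)) \<le> exp (- \<theta> / 2 * truncated_mean \<alpha> (1 / \<theta>))"
proof -
  have bd: "AE \<omega> in M. exp (- \<theta> * tau x \<omega>) \<le> 1 - \<theta> / 2 * min (tau x \<omega>) (1 / \<theta>)"
    using AE_tau_gt[of x]
  proof eventually_elim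
    case (elim \<omega>)
    then have "0 \<le> \<theta> * tau x \<omega>" using \<theta> by simp
    from exp_minus_le[OF this] have "exp (- \<theta> * tau x \<omega>) \<le> 1 - min (\<theta> * tau x \<omega>) 1 / 2" by simp
    also have "min (\<theta> * tau x \<omega>) 1 = \<theta> * min (tau x \<omega>) (1 / \<theta>)"
      using \<theta> by (simp add: min_mult_distrib_left)
    finally show ?case by simp
  qed
  have "expectation (\<lambda>\<omega>. exp (- \<theta> * tau x \<omega>)) \<le> expectation (\<lambda>\<omega>. 1 - \<theta> / 2 * min (tau x \<omega>) (1 / \<theta>))"
  proof (rule integral_mono_AE[OF _ _ bd])
    show "integrable M (\<lambda>\<omega>. exp (- \<theta> * tau x \<omega>))"
    proof (rule integrable_const_bound[where B=1])
      show "AE \<omega> in M. norm (exp (- \<theta> * tau x \<omega>)) \<le> 1"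
        using AE_tau_gt[of x] by eventually_elim (use \<theta> in simp)
    qed measurable
  qed (intro integrable_const Bochner_Integration.integrable_diff integrable_mult_right integrable_min)
  also have "\<dots> = 1 - \<theta> / 2 * truncated_mean \<alpha> (1 / \<theta>)"
    using \<theta> by (subst Bochner_Integration.integral_diff)
      (auto simp: integrable_min expectation_min prob_space intro!: integrable_mult_right)
  also have "\<dots> \<le> exp (- \<theta> / 2 * truncated_mean \<alpha> (1 / \<theta>))"
    using exp_ge_add_one_self[of "- \<theta> / 2 * truncated_mean \<alpha> (1 / \<theta>)"] by simp
  finally show ?thesis .
qed

abbreviation volume :: "nat \<Rightarrow> 'a \<Rightarrow> real" where
  "volume r \<omega> \<equiv> vol (\<lambda>x. tau x \<omega>) r"

lemma volume_measurable [measurable]: "volume r \<in> borel_measurable M"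
  unfolding vol_def by measurable

text \<open>Chernoff bound: Markov's inequality for \<open>exp (- \<theta> * V)\<close>, whose mean
  factorises by independence.\<close>

lemma prob_volume_le:
  assumes \<theta>: "0 < \<theta>" "\<theta> \<le> 1"
  shows "prob {\<omega> \<in> space M. volume r \<omega> \<le> v}
    \<le> exp (\<theta> * v - real (2 * r + 1) * (\<theta> / 2 * truncated_mean \<alpha> (1 / \<theta>)))"
proof -
  let ?I = "{- int r..int r}" and ?X = "\<lambda>x \<omega>. exp (- \<theta> * tau x \<omega>)"
  have int: "integrable M (?X x)" for x
  proof (rule integrable_const_bound[where B=1])
    show "AE \<omega> in M. norm (exp (- \<theta> * tau x \<omega>)) \<le> 1"
      using AE_tau_gt[of x] by eventually_elim (use \<theta> in simp)
  qed measurable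
  have ind: "indep_vars (\<lambda>_. borel) ?X ?I"
    by (rule indep_vars_compose2[OF indep_vars_subset[OF indep]]) auto
  have prod: "exp (- \<theta> * volume r \<omega>) = (\<Prod>x\<in>?I. ?X x \<omega>)" for \<omega>
    by (simp add: vol_def sum_distrib_left exp_sum sum_negf[symmetric])
  have vol_iff: "volume r \<omega> \<le> v \<longleftrightarrow> exp (- \<theta> * v) \<le> exp (- \<theta> * volume r \<omega>)" for \<omega>
    using \<theta> by simp
  have "{\<omega> \<in> space M. volume r \<omega> \<le> v} = {\<omega> \<in> space M. exp (- \<theta> * volume r \<omega>) \<ge> exp (- \<theta> * v)}"
    by (simp only: vol_iff)
  also have "prob \<dots> \<le> expectation (\<lambda>\<omega>. exp (- \<theta> * volume r \<omega>)) / exp (- \<theta> * v)"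
    unfolding prod
    by (intro integral_Markov_inequality_measure[where A="{}"] indep_vars_integrable ind int)
      (auto intro!: prod_nonneg)
  also have "expectation (\<lambda>\<omega>. exp (- \<theta> * volume r \<omega>)) = (\<Prod>x\<in>?I. expectation (?X x))"
    unfolding prod by (intro indep_vars_lebesgue_integral ind int) auto
  also have "\<dots> \<le> (\<Prod>x\<in>?I. exp (- \<theta> / 2 * truncated_mean \<alpha> (1 / \<theta>)))"
    by (intro prod_mono conjI expectation_exp_le \<theta> Bochner_Integration.integral_nonneg) auto
  also have "\<dots> = exp (- (real (2 * r + 1) * (\<theta> / 2 * truncated_mean \<alpha> (1 / \<theta>))))"
  proof -
    have "card ?I = 2 * r + 1" by simp
    then show ?thesis by (simp only: prod_constant exp_of_nat_mult[symmetric]) simp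
  qed
  finally have "prob {\<omega> \<in> space M. volume r \<omega> \<le> v}
      \<le> exp (- (real (2 * r + 1) * (\<theta> / 2 * truncated_mean \<alpha> (1 / \<theta>)))) / exp (- \<theta> * v)"
    by (simp add: divide_right_mono)
  then show ?thesis by (simp only: exp_diff[symmetric]) simp
qed

text \<open>Either some trap exceeds \<open>T\<close>, handled by a union bound, or the volume
  equals its truncated version, handled by Markov. For \<alpha> \<le> 1 the truncation is essential,
  the mean depth being infinite.\<close>

lemma prob_volume_gt:
  assumes T: "T \<ge> 1" and v: "v > 0"
  shows "prob {\<omega> \<in> space M. volume r \<omega> > v} \<le> real (2 * r + 1) * (T powr - \<alpha> + truncated_mean \<alpha> T / v)"
proof -
  let ?I = "{- int r..int r}"
  let ?S = "\<lambda>\<omega>. \<Sum>x\<in>?I. min (tau x \<omega>) T"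
  have card: "real (card ?I) = real (2 * r + 1)" by simp
  have "prob {\<omega> \<in> space M. volume r \<omega> > v}
      \<le> prob ((\<Union>x\<in>?I. {\<omega> \<in> space M. tau x \<omega> > T}) \<union> {\<omega> \<in> space M. ?S \<omega> \<ge> v})"
  proof (rule finite_measure_mono)
    show "{\<omega> \<in> space M. volume r \<omega> > v}
        \<subseteq> (\<Union>x\<in>?I. {\<omega> \<in> space M. tau x \<omega> > T}) \<union> {\<omega> \<in> space M. ?S \<omega> \<ge> v}"
    proof
      fix \<omega> assume w: "\<omega> \<in> {\<omega> \<in> space M. volume r \<omega> > v}"
      show "\<omega> \<in> (\<Union>x\<in>?I. {\<omega> \<in> space M. tau x \<omega> > T}) \<union> {\<omega> \<in> space M. ?S \<omega> \<ge> v}"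
      proof (cases "\<exists>x\<in>?I. tau x \<omega> > T")
        case False
        then have "?S \<omega> = volume r \<omega>" unfolding vol_def by (intro sum.cong refl) (simp add: min_absorb1 not_less)
        then show ?thesis using w by auto
      qed (use w in auto)
    qed
  qed measurable
  also have "\<dots> \<le> prob (\<Union>x\<in>?I. {\<omega> \<in> space M. tau x \<omega> > T}) + prob {\<omega> \<in> space M. ?S \<omega> \<ge> v}"
    by (rule measure_Un_le) measurable
  also have "prob (\<Union>x\<in>?I. {\<omega> \<in> space M. tau x \<omega> > T}) \<le> (\<Sum>x\<in>?I. prob {\<omega> \<in> space M. tau x \<omega> > T})"
    by (rule finite_measure_subadditive_finite) auto
  also have "\<dots> = real (2 * r + 1) * T powr - \<alpha>"
    using card by (simp add: tail[OF T])
  also have "prob {\<omega> \<in> space M. ?S \<omega> \<ge> v} \<le> expectation ?S / v"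
  proof (rule integral_Markov_inequality_measure[where A="{}"])
    show "AE \<omega> in M. 0 \<le> ?S \<omega>"
      using AE_tau_gt_1
    proof eventually_elim
      case (elim \<omega>)
      then have "0 \<le> min (tau x \<omega>) T" for x
        using T order.strict_trans[OF zero_less_one, of "tau x \<omega>"] by (simp add: less_imp_le)
      then show ?case by (intro sum_nonneg)
    qed
  qed (use v in \<open>auto intro!: integrable_min\<close>)
  also have "expectation ?S = real (2 * r + 1) * truncated_mean \<alpha> T"
    using card by (simp add: integrable_min expectation_min[OF T])
  finally show ?thesis by (simp only: distrib_left times_divide_eq_right)
qed

end

section \<open>Asymptotics of the scaling function\<close>

lemma phi_alpha_pos: "t > 1 \<Longrightarrow> phi_alpha \<alpha> t > 0"
  by (simp add: phi_alpha_def)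

text \<open>Up to a factor, the left side is the mean volume at distance \<open>t \<phi>\<close>
  with depths cut at order \<open>1 / \<phi>\<close>; that this has order \<open>1 / \<phi>\<close>
  is what fixes the scaling function.\<close>

lemma scaled_truncated_mean_bound:
  assumes \<alpha>: "\<alpha> > 0" and B: "B \<ge> 1"
  shows "\<exists>C>0. \<forall>\<^sub>F t in at_top.
    t * phi_alpha \<alpha> t * truncated_mean \<alpha> (B / phi_alpha \<alpha> t) \<le> C / phi_alpha \<alpha> t"
proof -
  consider "\<alpha> < 1" | "\<alpha> = 1" | "\<alpha> > 1" by linarith
  then show ?thesis
  proof cases
    case 1
    have "t * phi_alpha \<alpha> t * truncated_mean \<alpha> (B / phi_alpha \<alpha> t)
      \<le> B powr (1 - \<alpha>) / (1 - \<alpha>) / phi_alpha \<alpha> t" if t: "t > 1" for t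
    proof -
      \<comment> \<open>With \<open>m = 1 / \<phi>\<close> the time is
        \<open>m powr (1 + \<alpha>)\<close>, so all terms are powers of \<open>m\<close>.\<close>
      define m where "m = t powr (1 / (1 + \<alpha>))"
      have m: "m > 0" "phi_alpha \<alpha> t = 1 / m"
        using t 1 by (simp_all add: m_def phi_alpha_def powr_minus_divide)
      have tm: "t = m powr (1 + \<alpha>)"
        using t \<alpha> by (simp add: m_def powr_powr)
      have "truncated_mean \<alpha> (B * m) \<le> (B * m) powr (1 - \<alpha>) / (1 - \<alpha>)"
        using 1 \<alpha> by (simp add: truncated_mean_def field_simps)
      then have "t / m * truncated_mean \<alpha> (B * m) \<le> t / m * ((B * m) powr (1 - \<alpha>) / (1 - \<alpha>))"
        using t m by (intro mult_left_mono) auto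
      also have "\<dots> = B powr (1 - \<alpha>) / (1 - \<alpha>) * (m powr (1 + \<alpha>) * m powr (1 - \<alpha>) / m)"
        using B m by (simp add: tm powr_mult mult_ac)
      also have "m powr (1 + \<alpha>) * m powr (1 - \<alpha>) / m = m"
        using m by (simp add: powr_add[symmetric] power2_eq_square)
      finally show ?thesis using m by simp
    qed
    then show ?thesis
      using 1 B by (intro exI[of _ "B powr (1 - \<alpha>) / (1 - \<alpha>)"] conjI eventually_mono[OF eventually_gt_at_top[of 1]]) auto
  next
    case 2
    \<comment> \<open>Here \<open>t \<phi>^2 = 1 / ln t\<close> and the truncated mean is about
      \<open>ln t / 2\<close>, so the left side is about \<open>1 / (2 \<phi>)\<close>.\<close>
    have "\<forall>\<^sub>F t in at_top. t * (t powr (-1/2) * ln t powr (-1/2)) * (1 + ln (B / (t powr (-1/2) * ln t powr (-1/2))))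
      \<le> 2 / (t powr (-1/2) * ln t powr (-1/2))"
      using B by real_asymp
    then show ?thesis
      using 2 by (intro exI[of _ 2]) (simp add: phi_alpha_def truncated_mean_def)
  next
    case 3
    have "t * phi_alpha \<alpha> t * truncated_mean \<alpha> (B / phi_alpha \<alpha> t)
      \<le> (1 + 1 / (\<alpha> - 1)) / phi_alpha \<alpha> t" if t: "t > 1" for t
    proof -
      define m where "m = t powr (1 / 2)"
      have m: "m > 0" "phi_alpha \<alpha> t = 1 / m"
        using t 3 by (simp_all add: m_def phi_alpha_def powr_minus_divide)
      have tm: "t = m * m"
        using t by (simp add: m_def powr_add[symmetric])
      have "truncated_mean \<alpha> (B * m) = 1 + (1 - (B * m) powr (1 - \<alpha>)) / (\<alpha> - 1)"
        using 3 by (simp add: truncated_mean_def field_simps)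
      also have "\<dots> \<le> 1 + 1 / (\<alpha> - 1)"
        using 3 by (intro add_left_mono divide_right_mono) auto
      finally have "m * truncated_mean \<alpha> (B * m) \<le> m * (1 + 1 / (\<alpha> - 1))"
        using m by (intro mult_left_mono) auto
      then show ?thesis using m by (simp add: tm mult.commute)
    qed
    then show ?thesis
      using 3 by (intro exI[of _ "1 + 1 / (\<alpha> - 1)"] conjI eventually_mono[OF eventually_gt_at_top[of 1]])
        (auto simp: add_pos_pos)
  qed
qed

text \<open>This is the gain in the Chernoff exponent for \<open>\<theta> = A \<phi>\<close>. For
  large \<open>t\<close> it is at least of order \<open>A powr \<alpha>\<close> if \<alpha> < 1 and
  of order \<open>A\<close> otherwise, so \<open>A\<close> can push it above any
  \<open>Y\<close>.\<close>

lemma scaled_truncated_mean_unbounded: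
  assumes \<alpha>: "\<alpha> > 0"
  shows "\<exists>A\<ge>1. \<forall>\<^sub>F t in at_top.
    t * phi_alpha \<alpha> t * (A * phi_alpha \<alpha> t) * truncated_mean \<alpha> (1 / (A * phi_alpha \<alpha> t)) \<ge> Y"
proof -
  consider "\<alpha> < 1" | "\<alpha> = 1" | "\<alpha> > 1" by linarith
  then show ?thesis
  proof cases
    case 1
    define A where "A = (max 1 Y) powr (1 / \<alpha>)"
    have A: "A \<ge> 1" "A powr \<alpha> \<ge> Y" using \<alpha> by (simp_all add: A_def powr_powr ge_one_powr_ge_zero)
    have "\<forall>\<^sub>F t in at_top. t powr (1 / (1 + \<alpha>)) \<ge> A" using \<alpha> by real_asymp
    then have "\<forall>\<^sub>F t in at_top.
      t * phi_alpha \<alpha> t * (A * phi_alpha \<alpha> t) * truncated_mean \<alpha> (1 / (A * phi_alpha \<alpha> t)) \<ge> Y"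
      using eventually_gt_at_top[of 1]
    proof eventually_elim
      case (elim t)
      define m where "m = t powr (1 / (1 + \<alpha>))"
      have m: "m > 0" "phi_alpha \<alpha> t = 1 / m"
        using elim 1 by (simp_all add: m_def phi_alpha_def powr_minus_divide)
      have tm: "t = m powr (1 + \<alpha>)"
        using elim \<alpha> by (simp add: m_def powr_powr)
      have ge1: "(m / A) powr (1 - \<alpha>) \<ge> 1"
        using elim 1 A m by (intro ge_one_powr_ge_zero) (auto simp: m_def)
      have "((m / A) powr (1 - \<alpha>) - 1) * 1 \<le> ((m / A) powr (1 - \<alpha>) - 1) * (1 / (1 - \<alpha>))"
        using ge1 1 \<alpha> by (intro mult_left_mono) auto
      then have ge: "(m / A) powr (1 - \<alpha>) \<le> truncated_mean \<alpha> (m / A)"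
        using 1 by (simp add: truncated_mean_def)
      have "Y \<le> A powr \<alpha>" by (rule A)
      also have "A powr \<alpha> = t * A / m\<^sup>2 * (m / A) powr (1 - \<alpha>)"
        using A m by (simp add: tm powr_add powr_diff powr_divide power2_eq_square)
      also have "\<dots> \<le> t * A / m\<^sup>2 * truncated_mean \<alpha> (m / A)"
        using ge elim A m by (intro mult_left_mono) auto
      finally show ?case using m by (simp add: power2_eq_square)
    qed
    then show ?thesis using A by blast
  next
    case 2
    \<comment> \<open>The expression in \<open>t\<close> tends to \<open>A / 2\<close>, so
      \<open>A / 4\<close> is eventually a lower bound.\<close>
    define A where "A = max 1 (4 * Y)"
    have A: "A \<ge> 1" "A > 0" "A / 4 \<ge> Y" by (auto simp: A_def)
    have "\<forall>\<^sub>F t in at_top. t * (t powr (-1/2) * ln t powr (-1/2)) * (A * (t powr (-1/2) * ln t powr (-1/2)))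
       * (1 + ln (1 / (A * (t powr (-1/2) * ln t powr (-1/2))))) \<ge> A / 4"
      using A(2) by real_asymp
    then have "\<forall>\<^sub>F t in at_top.
        t * phi_alpha \<alpha> t * (A * phi_alpha \<alpha> t) * truncated_mean \<alpha> (1 / (A * phi_alpha \<alpha> t)) \<ge> Y"
    proof eventually_elim
      case (elim t)
      have "Y \<le> A / 4" by (rule A)
      also note elim
      finally show ?case using 2 by (simp only: phi_alpha_def truncated_mean_def) simp
    qed
    then show ?thesis using A by blast
  next
    case 3
    define A where "A = max 1 Y"
    have A: "A \<ge> 1" "A \<ge> Y" by (auto simp: A_def)
    have "\<forall>\<^sub>F t in at_top. t powr (1 / 2) \<ge> A" by real_asymp
    then have "\<forall>\<^sub>F t in at_top.
      t * phi_alpha \<alpha> t * (A * phi_alpha \<alpha> t) * truncated_mean \<alpha> (1 / (A * phi_alpha \<alpha> t)) \<ge> Y"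
      using eventually_gt_at_top[of 1]
    proof eventually_elim
      case (elim t)
      define m where "m = t powr (1 / 2)"
      have m: "m > 0" "phi_alpha \<alpha> t = 1 / m"
        using elim 3 by (simp_all add: m_def phi_alpha_def powr_minus_divide)
      have tm: "t = m * m"
        using elim by (simp add: m_def powr_add[symmetric])
      have "truncated_mean \<alpha> (m / A) \<ge> 1"
        using elim A by (intro truncated_mean_ge_1) (simp add: m_def)
      then have "A * 1 \<le> A * truncated_mean \<alpha> (m / A)"
        using A by (intro mult_left_mono) auto
      with A(2) have "Y \<le> A * truncated_mean \<alpha> (m / A)" by linarith
      then show ?case using m A by (simp add: tm)
    qed
    then show ?thesis using A by blast
  qed
qed

text \<open>Up to a factor, the mean number of traps deeper than \<open>1 / \<phi>\<close> within
  distance \<open>t \<phi>\<close>. It is exactly 1 for \<alpha> < 1 and \<open>1 / ln t\<close> for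
  \<alpha> = 1.\<close>

lemma scale_powr_le:
  assumes \<alpha>: "\<alpha> > 0"
  shows "\<forall>\<^sub>F t in at_top. t * phi_alpha \<alpha> t * (1 / phi_alpha \<alpha> t) powr - \<alpha> \<le> 1"
proof -
  consider "\<alpha> < 1" | "\<alpha> = 1" | "\<alpha> > 1" by linarith
  then show ?thesis
  proof cases
    case 1
    have "t * phi_alpha \<alpha> t * (1 / phi_alpha \<alpha> t) powr - \<alpha> \<le> 1" if t: "t > 1" for t
    proof -
      define m where "m = t powr (1 / (1 + \<alpha>))"
      have m: "m > 0" "phi_alpha \<alpha> t = 1 / m"
        using t 1 by (simp_all add: m_def phi_alpha_def powr_minus_divide)
      have tm: "t = m powr (1 + \<alpha>)"
        using t \<alpha> by (simp add: m_def powr_powr)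
      have "t * (1 / m) * m powr - \<alpha> = 1"
        using m(1) by (simp add: tm powr_add powr_minus)
      then show ?thesis by (simp add: m(2))
    qed
    then show ?thesis by (intro eventually_mono[OF eventually_gt_at_top[of 1]])
  next
    case 2
    have "t * phi_alpha \<alpha> t * (1 / phi_alpha \<alpha> t) powr - \<alpha> \<le> 1" if t: "t \<ge> exp 1" for t
    proof -
      have t1: "t > 0" using t by (rule less_le_trans[OF exp_gt_zero])
      then have ln: "ln t \<ge> 1" using t by (simp add: ln_ge_iff)
      have sq: "x powr (- 1 / 2) * x powr (- 1 / 2) = 1 / x" if "x > 0" for x :: real
        using that by (simp add: powr_add[symmetric] powr_minus_divide)
      have "t * phi_alpha \<alpha> t * (1 / phi_alpha \<alpha> t) powr - \<alpha> = t * (phi_alpha \<alpha> t * phi_alpha \<alpha> t)"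
        using t1 ln 2 by (simp add: phi_alpha_def powr_minus_divide)
      also have "phi_alpha \<alpha> t * phi_alpha \<alpha> t
          = (t powr (- 1 / 2) * t powr (- 1 / 2)) * (ln t powr (- 1 / 2) * ln t powr (- 1 / 2))"
        using 2 by (simp add: phi_alpha_def)
      also have "\<dots> = 1 / t * (1 / ln t)"
        using t1 ln by (simp only: sq)
      finally show ?thesis using t1 frac_le[of 1 1 1 "ln t"] ln by simp
    qed
    then show ?thesis by (intro eventually_mono[OF eventually_ge_at_top[of "exp 1"]])
  next
    case 3
    have "t * phi_alpha \<alpha> t * (1 / phi_alpha \<alpha> t) powr - \<alpha> \<le> 1" if t: "t > 1" for t
    proof -
      define m where "m = t powr (1 / 2)"
      have m: "m \<ge> 1" "phi_alpha \<alpha> t = 1 / m"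
        using t 3 by (simp_all add: m_def phi_alpha_def powr_minus_divide ge_one_powr_ge_zero)
      have tm: "t = m * m"
        using t by (simp add: m_def powr_add[symmetric])
      have "m powr 1 * m powr - \<alpha> \<le> m powr 0"
        unfolding powr_add[symmetric] using m 3 by (intro powr_mono) auto
      then show ?thesis using m by (simp add: tm)
    qed
    then show ?thesis by (intro eventually_mono[OF eventually_gt_at_top[of 1]])
  qed
qed

lemma filterlim_scale:
  assumes "\<alpha> > 0"
  shows "filterlim (\<lambda>t. t * phi_alpha \<alpha> t) at_top at_top"
proof -
  consider "\<alpha> < 1" | "\<alpha> = 1" | "\<alpha> > 1" by linarith
  then show ?thesis
  proof cases
    case 1
    have "t * phi_alpha \<alpha> t = t powr (\<alpha> / (1 + \<alpha>))" if "t > 1" for t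
    proof -
      have "t powr 1 * t powr (- 1 / (1 + \<alpha>)) = t powr (\<alpha> / (1 + \<alpha>))"
        unfolding powr_add[symmetric] using assms by (simp add: field_simps)
      then show ?thesis using that 1 by (simp add: phi_alpha_def)
    qed
    then have ev: "\<forall>\<^sub>F t in at_top. t * phi_alpha \<alpha> t = t powr (\<alpha> / (1 + \<alpha>))"
      by (intro eventually_mono[OF eventually_gt_at_top[of 1]])
    have "filterlim (\<lambda>t::real. t powr (\<alpha> / (1 + \<alpha>))) at_top at_top"
      using assms by real_asymp
    then show ?thesis by (subst filterlim_cong[OF refl refl ev])
  next
    case 2
    have "filterlim (\<lambda>t::real. t * (t powr (-1/2) * ln t powr (-1/2))) at_top at_top"
      by real_asymp
    then show ?thesis using 2 by (simp add: phi_alpha_def)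
  next
    case 3
    have "filterlim (\<lambda>t::real. t * t powr (-1/2)) at_top at_top" by real_asymp
    then show ?thesis using 3 by (simp add: phi_alpha_def)
  qed
qed

lemma phi_alpha_tendsto_0:
  assumes "\<alpha> > 0"
  shows "((phi_alpha \<alpha>) \<longlongrightarrow> 0) at_top"
proof -
  consider "\<alpha> < 1" | "\<alpha> = 1" | "\<alpha> > 1" by linarith
  then show ?thesis
  proof cases
    case 1
    have "((\<lambda>t::real. t powr (- 1 / (1 + \<alpha>))) \<longlongrightarrow> 0) at_top" using assms by real_asymp
    then show ?thesis using 1 by (simp add: phi_alpha_def[abs_def])
  next
    case 2
    have "((\<lambda>t::real. t powr (-1/2) * ln t powr (-1/2)) \<longlongrightarrow> 0) at_top" by real_asymp
    then show ?thesis using 2 by (simp add: phi_alpha_def[abs_def])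
  next
    case 3
    have "((\<lambda>t::real. t powr (-1/2)) \<longlongrightarrow> 0) at_top" by real_asymp
    then show ?thesis using 3 by (simp add: phi_alpha_def[abs_def])
  qed
qed

section \<open>Tightness of the rescaled heat kernel\<close>

context random_traps
begin

lemma heat_kernel_measurable [measurable]:
  "(\<lambda>\<omega>. heat_kernel (\<lambda>x. tau x \<omega>) t x y) \<in> borel_measurable M"
proof -
  have [measurable]: "(\<lambda>\<omega>. gen_pow (\<lambda>x. tau x \<omega>) n x y) \<in> borel_measurable M" for n x y
  proof (induction n arbitrary: x)
    case (Suc n)
    note [measurable] = Suc
    have [measurable]: "(\<lambda>\<omega>. bouchaud_gen (\<lambda>x. tau x \<omega>) x z) \<in> borel_measurable M" for z
      unfolding bouchaud_gen_def by measurable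
    show ?case by simp
  qed simp
  show ?thesis unfolding heat_kernel_def trans_prob_def by measurable
qed

text \<open>Chernoff with \<open>\<theta> = A \<phi>\<close> and level
  \<open>1 / (A \<phi>)\<close>, so that \<open>\<theta> v = 1\<close>. The choice
  \<open>Y = 1 - ln \<epsilon>\<close> compensates this 1 and leaves
  \<open>exp (ln \<epsilon>)\<close>.\<close>

lemma volume_lower_bound:
  assumes \<epsilon>: "\<epsilon> > 0"
  shows "\<exists>\<delta>>0. \<forall>\<^sub>F t in at_top.
    prob {\<omega> \<in> space M. volume (nat \<lceil>t * phi_alpha \<alpha> t\<rceil>) \<omega> \<le> \<delta> / phi_alpha \<alpha> t} \<le> \<epsilon>"
proof -
  obtain A where A: "A \<ge> 1" and ev: "\<forall>\<^sub>F t in at_top. 1 - ln \<epsilon>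
      \<le> t * phi_alpha \<alpha> t * (A * phi_alpha \<alpha> t) * truncated_mean \<alpha> (1 / (A * phi_alpha \<alpha> t))"
    using scaled_truncated_mean_unbounded[OF alpha_pos, of "1 - ln \<epsilon>"] by blast
  have small: "\<forall>\<^sub>F t in at_top. phi_alpha \<alpha> t < 1 / A"
    using order_tendstoD(2)[OF phi_alpha_tendsto_0[OF alpha_pos], of "1 / A"] A by simp
  have "\<forall>\<^sub>F t in at_top.
    prob {\<omega> \<in> space M. volume (nat \<lceil>t * phi_alpha \<alpha> t\<rceil>) \<omega> \<le> (1 / A) / phi_alpha \<alpha> t} \<le> \<epsilon>"
    using ev small eventually_gt_at_top[of 1]
  proof eventually_elim
    case (elim t)
    define \<phi> r \<theta> where "\<phi> = phi_alpha \<alpha> t" and "r = nat \<lceil>t * \<phi>\<rceil>" and "\<theta> = A * \<phi>"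
    define J where "J = truncated_mean \<alpha> (1 / \<theta>)"
    have \<phi>: "\<phi> > 0" using phi_alpha_pos elim by (simp add: \<phi>_def)
    have \<theta>: "0 < \<theta>" "\<theta> \<le> 1" using A \<phi> elim by (simp_all add: \<theta>_def \<phi>_def field_simps)
    have J: "J \<ge> 0" using truncated_mean_ge_1[of "1 / \<theta>" \<alpha>] \<theta> by (simp add: J_def)
    have r: "t * \<phi> * 2 \<le> real (2 * r + 1)" using real_nat_ceiling_ge[of "t * \<phi>"] by (simp add: r_def)
    have "prob {\<omega> \<in> space M. volume r \<omega> \<le> 1 / A / \<phi>}
        \<le> exp (\<theta> * (1 / A / \<phi>) - real (2 * r + 1) * (\<theta> / 2 * J))"
      unfolding J_def by (rule prob_volume_le[OF \<theta>])
    also have "\<theta> * (1 / A / \<phi>) = 1" using A \<phi> by (simp add: \<theta>_def)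
    also have "exp (1 - real (2 * r + 1) * (\<theta> / 2 * J)) \<le> exp (1 - t * \<phi> * 2 * (\<theta> / 2 * J))"
      using \<theta> J mult_right_mono[OF r, of "\<theta> / 2 * J"] by simp
    also have "\<dots> \<le> exp (ln \<epsilon>)"
      using elim(1) by (simp add: J_def \<theta>_def \<phi>_def mult_ac)
    also have "\<dots> = \<epsilon>" using \<epsilon> by simp
    finally show ?case by (simp add: r_def \<phi>_def)
  qed
  then show ?thesis using A by (intro exI[of _ "1 / A"]) auto
qed

lemma volume_upper_bound:
  assumes \<epsilon>: "\<epsilon> > 0" and C: "C > 0"
  shows "\<exists>K>0. \<forall>\<^sub>F t in at_top.
    prob {\<omega> \<in> space M. volume (nat \<lceil>C * (t * phi_alpha \<alpha> t)\<rceil>) \<omega> > K / phi_alpha \<alpha> t} \<le> \<epsilon>"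
proof -
  \<comment> \<open>Once \<open>t \<phi> >= 1\<close>, the ball has at most
    \<open>2 (C t \<phi> + 1) + 1 <= D t \<phi>\<close> sites.\<close>
  define D where "D = 2 * C + 3"
  have D: "D > 0" using C by (simp add: D_def)
  \<comment> \<open>Truncating at \<open>B / \<phi>\<close>, this \<open>B\<close> makes the union
    bound cost at most half of \<epsilon>.\<close>
  define B where "B = max 1 ((2 * D / \<epsilon>) powr (1 / \<alpha>))"
  have B: "B \<ge> 1" by (simp add: B_def)
  have "(2 * D / \<epsilon>) powr (1 / \<alpha>) \<le> B" by (simp add: B_def)
  then have "((2 * D / \<epsilon>) powr (1 / \<alpha>)) powr \<alpha> \<le> B powr \<alpha>"
    using alpha_pos by (intro powr_mono2) auto
  then have "2 * D / \<epsilon> \<le> B powr \<alpha>" using alpha_pos D \<epsilon> by (simp add: powr_powr)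
  then have DB: "D * B powr - \<alpha> \<le> \<epsilon> / 2"
    using \<epsilon> B by (simp add: powr_minus field_simps)
  obtain C' where C': "C' > 0" and ev: "\<forall>\<^sub>F t in at_top.
      t * phi_alpha \<alpha> t * truncated_mean \<alpha> (B / phi_alpha \<alpha> t) \<le> C' / phi_alpha \<alpha> t"
    using scaled_truncated_mean_bound[OF alpha_pos B] by blast
  \<comment> \<open>Makes the first moment part \<open>D C' / K\<close> equal to the other half of
    \<epsilon>.\<close>
  define K where "K = 2 * D * C' / \<epsilon>"
  have K: "K > 0" using D C' \<epsilon> by (simp add: K_def)
  have small: "\<forall>\<^sub>F t in at_top. phi_alpha \<alpha> t < 1"
    using order_tendstoD(2)[OF phi_alpha_tendsto_0[OF alpha_pos], of 1] by simp
  have large: "\<forall>\<^sub>F t in at_top. t * phi_alpha \<alpha> t \<ge> 1"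
    using filterlim_scale[OF alpha_pos] by (simp add: filterlim_at_top)
  have "\<forall>\<^sub>F t in at_top.
    prob {\<omega> \<in> space M. volume (nat \<lceil>C * (t * phi_alpha \<alpha> t)\<rceil>) \<omega> > K / phi_alpha \<alpha> t} \<le> \<epsilon>"
    using ev small large scale_powr_le[OF alpha_pos] eventually_gt_at_top[of 1]
  proof eventually_elim
    case (elim t)
    define \<phi> r where "\<phi> = phi_alpha \<alpha> t" and "r = nat \<lceil>C * (t * \<phi>)\<rceil>"
    have \<phi>: "\<phi> > 0" "\<phi> < 1" "t * \<phi> \<ge> 1" using phi_alpha_pos elim by (simp_all add: \<phi>_def)
    have "real r \<le> C * (t * \<phi>) + 1"
      using C \<phi> by (simp add: r_def)
    then have r: "real (2 * r + 1) \<le> D * (t * \<phi>)"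
      using \<phi> by (simp add: D_def algebra_simps)
    define J where "J = truncated_mean \<alpha> (B / \<phi>)"
    have T: "B / \<phi> \<ge> 1" using B \<phi> by simp
    have J: "J \<ge> 0" using truncated_mean_ge_1[OF T, of \<alpha>] by (simp add: J_def)
    have "prob {\<omega> \<in> space M. volume r \<omega> > K / \<phi>}
        \<le> real (2 * r + 1) * ((B / \<phi>) powr - \<alpha> + J / (K / \<phi>))"
      unfolding J_def using T K \<phi> by (intro prob_volume_gt) auto
    also have "\<dots> \<le> D * (t * \<phi>) * ((B / \<phi>) powr - \<alpha> + J / (K / \<phi>))"
      using r J K \<phi> by (intro mult_right_mono) auto
    also have "\<dots> = D * B powr - \<alpha> * (t * \<phi> * (1 / \<phi>) powr - \<alpha>) + D / K * (t * \<phi> * J * \<phi>)"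
      using B \<phi> K by (simp add: powr_divide powr_minus field_simps)
    also have "\<dots> \<le> D * B powr - \<alpha> * 1 + D / K * (C' / \<phi> * \<phi>)"
      using elim D K \<phi> by (intro add_mono mult_left_mono mult_right_mono) (auto simp: \<phi>_def J_def)
    also have "D / K * (C' / \<phi> * \<phi>) = \<epsilon> / 2"
      using \<phi> D C' \<epsilon> by (simp add: K_def)
    finally show ?case using DB by (simp add: r_def \<phi>_def)
  qed
  then show ?thesis using K by blast
qed

text \<open>Outside two events of probability at most \<epsilon>, a small \<open>V(\<rho>)\<close>
  and a large \<open>V(r)\<close>, the deterministic bounds apply almost surely.\<close>

lemma heat_kernel_bounds:
  assumes \<epsilon>: "\<epsilon> > 0"
  shows "\<exists>\<Lambda>. \<forall>lam\<ge>\<Lambda>. \<forall>\<^sub>F t in at_top.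
    prob {\<omega> \<in> space M. 1 / lam \<le> heat_kernel (\<lambda>x. tau x \<omega>) t 0 0 / phi_alpha \<alpha> t
      \<and> heat_kernel (\<lambda>x. tau x \<omega>) t 0 0 / phi_alpha \<alpha> t \<le> lam} \<ge> 1 - 2 * \<epsilon>"
proof -
  obtain \<delta> where \<delta>: "\<delta> > 0" and lower: "\<forall>\<^sub>F t in at_top.
      prob {\<omega> \<in> space M. volume (nat \<lceil>t * phi_alpha \<alpha> t\<rceil>) \<omega> \<le> \<delta> / phi_alpha \<alpha> t} \<le> \<epsilon>"
    using volume_lower_bound[OF \<epsilon>] by blast
  \<comment> \<open>\<open>heat_kernel_lower\<close> asks for
    \<open>r >= 2 (2 t + 1) / V(\<rho>) + 4 \<rho>\<close>. Inserting
    \<open>V(\<rho>) > \<delta> / \<phi>\<close>, \<open>\<rho> <= 2 t \<phi>\<close> and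
    \<open>2 t + 1 <= 3 t\<close> gives \<open>C t \<phi>\<close>. As \<open>C\<close> depends on
    \<delta>, the upper volume bound comes second.\<close>
  define C where "C = 6 / \<delta> + 8"
  have C: "C > 0" using \<delta> by (simp add: C_def add_pos_pos)
  obtain K where K: "K > 0" and upper: "\<forall>\<^sub>F t in at_top.
      prob {\<omega> \<in> space M. volume (nat \<lceil>C * (t * phi_alpha \<alpha> t)\<rceil>) \<omega> > K / phi_alpha \<alpha> t} \<le> \<epsilon>"
    using volume_upper_bound[OF \<epsilon> C] by blast
  have large: "\<forall>\<^sub>F t in at_top. t * phi_alpha \<alpha> t \<ge> 1"
    using filterlim_scale[OF alpha_pos] by (simp add: filterlim_at_top)
  show ?thesis
  \<comment> \<open>The first entry comes from \<open>1 / (8 V(r))\<close> with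
    \<open>V(r) <= K / \<phi>\<close>, the second from
    \<open>2 / V(\<rho>) + 2 \<rho> / t\<close>.\<close>
  proof (intro exI[of _ "max (8 * K) (2 / \<delta> + 4)"] allI impI)
    fix lam assume "max (8 * K) (2 / \<delta> + 4) \<le> lam"
    then have lam: "8 * K \<le> lam" "2 / \<delta> + 4 \<le> lam" by auto
    show "\<forall>\<^sub>F t in at_top.
      prob {\<omega> \<in> space M. 1 / lam \<le> heat_kernel (\<lambda>x. tau x \<omega>) t 0 0 / phi_alpha \<alpha> t
        \<and> heat_kernel (\<lambda>x. tau x \<omega>) t 0 0 / phi_alpha \<alpha> t \<le> lam} \<ge> 1 - 2 * \<epsilon>"
      using lower upper large eventually_ge_at_top[of 2]
    proof eventually_elim
      case (elim t)
      define \<phi> \<rho> r where "\<phi> = phi_alpha \<alpha> t" and "\<rho> = nat \<lceil>t * \<phi>\<rceil>" and "r = nat \<lceil>C * (t * \<phi>)\<rceil>"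
      define G where "G = {\<omega> \<in> space M. 1 / lam \<le> heat_kernel (\<lambda>x. tau x \<omega>) t 0 0 / \<phi>
          \<and> heat_kernel (\<lambda>x. tau x \<omega>) t 0 0 / \<phi> \<le> lam}"
      define L where "L = {\<omega> \<in> space M. volume \<rho> \<omega> \<le> \<delta> / \<phi>}"
      define U where "U = {\<omega> \<in> space M. volume r \<omega> > K / \<phi>}"
      have [measurable]: "G \<in> sets M" "L \<in> sets M" "U \<in> sets M"
        unfolding G_def L_def U_def by measurable
      have \<phi>: "\<phi> > 0" "t * \<phi> \<ge> 1" "t > 0" using phi_alpha_pos elim by (simp_all add: \<phi>_def)
      have "real \<rho> \<le> t * \<phi> + 1" using \<phi> by (simp add: \<rho>_def)
      then have \<rho>: "real \<rho> \<le> 2 * (t * \<phi>)" using \<phi> by simp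
      have r: "real r \<ge> C * (t * \<phi>)" by (simp add: r_def real_nat_ceiling_ge)
      have "AE \<omega> in M. \<omega> \<in> space M \<longrightarrow> \<omega> \<in> L \<union> U \<union> G"
        using AE_tau_gt_1
      proof eventually_elim
        case (elim \<omega>)
        interpret trap_environment "\<lambda>x. tau x \<omega>"
          by standard (use elim in \<open>simp add: less_imp_le\<close>)
        show ?case
        proof (intro impI, rule ccontr)
          assume sp: "\<omega> \<in> space M" and "\<omega> \<notin> L \<union> U \<union> G"
          then have notG: "\<omega> \<notin> G" and V: "volume \<rho> \<omega> > \<delta> / \<phi>" "volume r \<omega> \<le> K / \<phi>"
            by (auto simp: L_def U_def)
          let ?p = "heat_kernel (\<lambda>x. tau x \<omega>) t 0 0"
          have inv: "c / volume \<rho> \<omega> \<le> c / \<delta> * \<phi>" if "c \<ge> 0" for c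
          proof -
            have "c / volume \<rho> \<omega> \<le> c / (\<delta> / \<phi>)"
              using V \<delta> \<phi> that vol_pos[of \<rho>] by (intro divide_left_mono) simp_all
            then show ?thesis by simp
          qed
          have "?p \<le> 2 / volume \<rho> \<omega> + 2 * real \<rho> / t"
            using heat_kernel_upper[OF \<phi>(3)] .
          also have "\<dots> \<le> 2 / \<delta> * \<phi> + 2 * (2 * (t * \<phi>)) / t"
            using inv[of 2] \<rho> \<phi> by (intro add_mono divide_right_mono mult_left_mono) auto
          also have "\<dots> = (2 / \<delta> + 4) * \<phi>" using \<phi> by (simp add: field_simps)
          also have "\<dots> \<le> lam * \<phi>" using lam \<phi> by (intro mult_right_mono) auto
          finally have up: "?p / \<phi> \<le> lam" using \<phi> by (simp add: divide_le_eq)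
          have "2 * (2 * t + 1) / volume \<rho> \<omega> + 4 * real \<rho> \<le> 2 * (2 * t + 1) / \<delta> * \<phi> + 4 * (2 * (t * \<phi>))"
            using inv[of "2 * (2 * t + 1)"] \<rho> \<phi> by (intro add_mono mult_left_mono) auto
          also have "2 * (2 * t + 1) / \<delta> * \<phi> \<le> 6 * t / \<delta> * \<phi>"
            using \<open>2 \<le> t\<close> \<delta> \<phi> by (intro mult_right_mono divide_right_mono) auto
          also have "6 * t / \<delta> * \<phi> + 4 * (2 * (t * \<phi>)) = C * (t * \<phi>)"
            by (simp add: C_def algebra_simps)
          finally have rr: "2 * (2 * t + 1) / volume \<rho> \<omega> + 4 * real \<rho> \<le> real r" using r by simp
          have "real r > 0" using r C \<phi> by (intro less_le_trans[OF _ r] mult_pos_pos) auto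
          then have "r > 0" by simp
          have "1 / lam \<le> 1 / (8 * K)" using lam K by (intro divide_left_mono) auto
          also have "\<dots> = 1 / (8 * (K / \<phi>)) / \<phi>" using \<phi> by simp
          also have "\<dots> \<le> 1 / (8 * volume r \<omega>) / \<phi>"
            using V \<phi> K vol_pos[of r] by (intro divide_right_mono divide_left_mono) auto
          also have "\<dots> \<le> ?p / \<phi>"
            using heat_kernel_lower[OF \<phi>(3) \<open>r > 0\<close> rr] \<phi> by (intro divide_right_mono) auto
          finally show False using up notG sp by (simp add: G_def)
        qed
      qed
      then have "prob (space M) \<le> prob (L \<union> U \<union> G)"
        by (intro finite_measure_mono_AE) auto
      also have "\<dots> \<le> prob L + prob U + prob G"
        using measure_Un_le[of "L \<union> U" M G] measure_Un_le[of L M U] by simp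
      also have "prob L \<le> \<epsilon>" using elim(1) by (simp add: L_def \<rho>_def \<phi>_def)
      also have "prob U \<le> \<epsilon>" using elim(2) by (simp add: U_def r_def \<phi>_def)
      finally have "1 - 2 * \<epsilon> \<le> prob G" by (simp add: prob_space)
      then show ?case by (simp add: G_def \<phi>_def)
    qed
  qed
qed

end

theorem mainTheorem4:
  fixes M :: "'a measure" and tau :: "int \<Rightarrow> 'a \<Rightarrow> real" and alpha :: real
  assumes "prob_space M"
    and "alpha > 0"
    and "prob_space.indep_vars M (\<lambda>_. borel) tau UNIV"
    and "\<forall>x u. u \<ge> 1 \<longrightarrow> measure M {\<omega> \<in> space M. tau x \<omega> > u} = u powr (- alpha)"
  shows "((\<lambda>lam. Liminf at_top (\<lambda>t. ereal (measure M
            {\<omega> \<in> space M. 1 / lam \<le> heat_kernel (\<lambda>x. tau x \<omega>) t 0 0 / phi_alpha alpha t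
                          \<and> heat_kernel (\<lambda>x. tau x \<omega>) t 0 0 / phi_alpha alpha t \<le> lam})))
          \<longlongrightarrow> 1) at_top"
proof -
  interpret prob_space M by fact
  interpret random_traps M tau alpha
    using assms by unfold_locales auto
  let ?P = "\<lambda>lam t. prob {\<omega> \<in> space M. 1 / lam \<le> heat_kernel (\<lambda>x. tau x \<omega>) t 0 0 / phi_alpha alpha t
                          \<and> heat_kernel (\<lambda>x. tau x \<omega>) t 0 0 / phi_alpha alpha t \<le> lam}"
  show ?thesis
  proof (rule order_tendstoI)
    fix a :: ereal assume "a < 1"
    \<comment> \<open>A real number is interposed because \<open>a\<close> may be minus
      infinity.\<close>
    then obtain b where b: "a < ereal b" "ereal b < 1"
      using ereal_dense2 by blast
    define \<epsilon> where "\<epsilon> = (1 - b) / 2"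
    have "\<epsilon> > 0" and b_eq: "1 - 2 * \<epsilon> = b" using b by (simp_all add: \<epsilon>_def field_simps)
    then obtain \<Lambda> where "\<forall>lam\<ge>\<Lambda>. \<forall>\<^sub>F t in at_top. ?P lam t \<ge> b"
      unfolding b_eq[symmetric] using heat_kernel_bounds by blast
    then have "\<forall>lam\<ge>\<Lambda>. ereal b \<le> Liminf at_top (\<lambda>t. ereal (?P lam t))"
      by (auto intro!: Liminf_bounded simp: b_eq)
    then show "\<forall>\<^sub>F lam in at_top. a < Liminf at_top (\<lambda>t. ereal (?P lam t))"
      using b by (auto simp: eventually_at_top_linorder intro: less_le_trans)
  next
    fix a :: ereal assume a: "1 < a"
    \<comment> \<open>The upper half of the limit is trivial: probabilities are at most 1.\<close>
    have "Liminf at_top (\<lambda>t. ereal (?P lam t)) \<le> 1" for lam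
    proof -
      have "Liminf at_top (\<lambda>t. ereal (?P lam t)) \<le> Liminf at_top (\<lambda>t::real. 1)"
        by (intro Liminf_mono always_eventually) auto
      then show ?thesis by (simp add: Liminf_const)
    qed
    then show "\<forall>\<^sub>F lam in at_top. Liminf at_top (\<lambda>t. ereal (?P lam t)) < a"
      using a by (intro always_eventually) (auto intro: le_less_trans)
  qed
qed

end
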